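(* Let $u_0\in C^2(\mathbb R)$ and suppose there exist $C_0,C_1>0$ such that $|u_0'|\ge C_0$ on $\mathbb R$ and $\left|\frac{u_0'(y)}{u_0(y)}\right|\le C_1$ for $|y|$ sufficiently large. Let $\varepsilon_0\in(0,C_0)$. Let $(u(x-ct,y),v(x-ct,y))$, with profile $(u,v)\in C^2(D_L^\infty)$ and wave speed $c\in\mathbb R$, be any genuine traveling-wave solution of the $\beta$-plane equation ($\beta\ge0$) in $D_L^\infty=\mathbb T_L\times\mathbb R$ with $v\to0$ as $y\to\pm\infty$ for $x\in\mathbb T_L$, satisfying $\partial_xv,\partial_yv\in L^\infty(D_L^\infty)$ and $$\|u-u_0\|_{W^{1,\infty}(D_L^\infty)}<\varepsilon_0 .$$ Then $c$ is a generalized inflection value of $u$, i.e. $\{\beta-\Delta u=0\}\cap\{u=c\}\neq\emptyset$.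
   Context: Let $L>0$, $\mathbb T_L=\mathbb R/L\mathbb Z$, $D_L^\infty=\mathbb T_L\times(-\infty,\infty)$. For a constant $\beta\ge0$, the $\beta$-plane equation on $D_L^\infty$ is $$u_t+uu_x+vu_y-\beta yv=-P_x,\quad v_t+uv_x+vv_y+\beta yu=-P_y,\quad u_x+v_y=0$$ ($P$ is the pressure), with the asymptotic condition $v\to0$ as $y\to\pm\infty$ for $x\in\mathbb T_L$. A traveling-wave solution of speed $c\in\mathbb R$ is a solution (for some pressure) of the form $(u(x-ct,y),v(x-ct,y))$, with profiles $u,v$ defined on $D_L^\infty$ ($L$-periodic in the first variable). It is a shear flow if $v\equiv0$ on $D_L^\infty$, and genuine if it is not a shear flow. The function $u_0=u_0(y)$ is regarded as a function on $D_L^\infty$ independent of $x$. $\Delta=\partial_x^2+\partial_y^2$. *)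

theory Defs
  imports "HOL-Probability.Essential_Supremum"
begin

text \<open>
  A function on \<open>D = \<T>\<^sub>L \<times> \<real>\<close>, where \<open>\<T>\<^sub>L = \<real> / L\<int>\<close>, is represented by a
  function on \<open>real \<times> real\<close> that is \<open>L\<close>-periodic in its first argument. Continuity,
  derivatives, null sets and essential suprema on \<open>D\<close> are those of the periodic lift.
\<close>

definition x_periodic :: "real \<Rightarrow> (real \<times> real \<Rightarrow> real) \<Rightarrow> bool" where
  "x_periodic L f \<longleftrightarrow> (\<forall>x y. f (x + L, y) = f (x, y))"

definition dx :: "(real \<times> real \<Rightarrow> real) \<Rightarrow> real \<times> real \<Rightarrow> real" where
  "dx f p = deriv (\<lambda>s. f (s, snd p)) (fst p)"

definition dy :: "(real \<times> real \<Rightarrow> real) \<Rightarrow> real \<times> real \<Rightarrow> real" where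
  "dy f p = deriv (\<lambda>s. f (fst p, s)) (snd p)"

definition laplacian :: "(real \<times> real \<Rightarrow> real) \<Rightarrow> real \<times> real \<Rightarrow> real" where
  "laplacian f p = dx (dx f) p + dy (dy f) p"

definition C2_line :: "(real \<Rightarrow> real) \<Rightarrow> bool" where
  "C2_line f \<longleftrightarrow>
     (\<forall>y. f differentiable (at y)) \<and>
     (\<forall>y. deriv f differentiable (at y)) \<and>
     continuous_on UNIV (deriv (deriv f))"

definition C1_plane :: "(real \<times> real \<Rightarrow> real) \<Rightarrow> bool" where
  "C1_plane f \<longleftrightarrow>
     continuous_on UNIV f \<and>
     (\<forall>x y. (\<lambda>s. f (s, y)) differentiable (at x)) \<and>
     (\<forall>x y. (\<lambda>s. f (x, s)) differentiable (at y)) \<and>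
     continuous_on UNIV (dx f) \<and> continuous_on UNIV (dy f)"

definition C2_plane :: "(real \<times> real \<Rightarrow> real) \<Rightarrow> bool" where
  "C2_plane f \<longleftrightarrow> C1_plane f \<and> C1_plane (dx f) \<and> C1_plane (dy f)"

text \<open>
  The value is in \<open>ereal\<close>, so that \<open>f \<in> L\<^sup>\<infinity>\<close> reads \<open>Linf_norm f < \<infinity>\<close>; for a
  non-measurable \<open>f\<close> the library's \<open>esssup\<close> is \<open>\<infinity>\<close>.
\<close>

definition Linf_norm :: "(real \<times> real \<Rightarrow> real) \<Rightarrow> ereal" where
  "Linf_norm f = esssup lborel (\<lambda>p. ereal \<bar>f p\<bar>)"

text \<open>
  The derivatives are classical ones, which agree with the weak ones for the \<open>C\<^sup>1\<close> functions
  to which the norm is applied. Among the usual equivalent norms on \<open>W\<^sup>1\<^sup>,\<^sup>\<infinity>\<close>, the maximum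
  over the derivatives is the smallest; the sum of the norms and the variant using the Euclidean
  length of the gradient dominate it.
\<close>

definition W1inf_norm :: "(real \<times> real \<Rightarrow> real) \<Rightarrow> ereal" where
  "W1inf_norm f = max (Linf_norm f) (max (Linf_norm (dx f)) (Linf_norm (dy f)))"

text \<open>
  Classical solutions of the \<open>\<beta>\<close>-plane equation for all times: \<open>U t\<close>, \<open>V t\<close>, \<open>P t\<close> are the
  velocity components and the pressure at time \<open>t\<close>. The pressure is a function on \<open>D\<close>, hence
  periodic as well.
\<close>

definition beta_plane_solution ::
  "real \<Rightarrow> real \<Rightarrow> (real \<Rightarrow> real \<times> real \<Rightarrow> real) \<Rightarrow> (real \<Rightarrow> real \<times> real \<Rightarrow> real) \<Rightarrow>
   (real \<Rightarrow> real \<times> real \<Rightarrow> real) \<Rightarrow> bool" where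
  "beta_plane_solution L \<beta> U V P \<longleftrightarrow>
     (\<forall>t. x_periodic L (U t) \<and> x_periodic L (V t) \<and> x_periodic L (P t)) \<and>
     (\<forall>t. C1_plane (U t) \<and> C1_plane (V t) \<and> C1_plane (P t)) \<and>
     (\<forall>t p. (\<lambda>s. U s p) differentiable (at t) \<and> (\<lambda>s. V s p) differentiable (at t)) \<and>
     (\<forall>t p.
        deriv (\<lambda>s. U s p) t + U t p * dx (U t) p + V t p * dy (U t) p - \<beta> * snd p * V t p
          = - dx (P t) p \<and>
        deriv (\<lambda>s. V s p) t + U t p * dx (V t) p + V t p * dy (V t) p + \<beta> * snd p * U t p
          = - dy (P t) p \<and>
        dx (U t) p + dy (V t) p = 0)"

definition traveling_wave_solution ::
  "real \<Rightarrow> real \<Rightarrow> real \<Rightarrow> (real \<times> real \<Rightarrow> real) \<Rightarrow> (real \<times> real \<Rightarrow> real) \<Rightarrow> bool" where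
  "traveling_wave_solution L \<beta> c u v \<longleftrightarrow>
     (\<exists>P. beta_plane_solution L \<beta>
            (\<lambda>t p. u (fst p - c * t, snd p)) (\<lambda>t p. v (fst p - c * t, snd p)) P)"

definition shear_flow :: "(real \<times> real \<Rightarrow> real) \<Rightarrow> (real \<times> real \<Rightarrow> real) \<Rightarrow> bool" where
  "shear_flow u v \<longleftrightarrow> (\<forall>p. v p = 0)"

definition generalized_inflection_value :: "real \<Rightarrow> (real \<times> real \<Rightarrow> real) \<Rightarrow> real \<Rightarrow> bool" where
  "generalized_inflection_value \<beta> u c \<longleftrightarrow>
     {p. \<beta> - laplacian u p = 0} \<inter> {p. u p = c} \<noteq> {}"

end

theory Submission
  imports Defs
begin

text \<open>
  Taking the curl of the momentum equations gives \<open>(u - c) \<Delta>v + v (\<beta> - \<Delta>u) = 0\<close>. By the hypotheses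
  on \<open>u\<^sub>0\<close>, \<open>u\<^sub>y\<close> is bounded away from zero, say positive (otherwise reflect in \<open>y\<close>). If \<open>\<beta> - \<Delta>u\<close>
  has no zero on \<open>{u = c}\<close>, then \<open>v = 0\<close> there, and \<open>w = v / (u - c)\<close> is bounded and satisfies
  \<open>div ((u - c)\<^sup>2 \<nabla>w) = -\<beta> (u - c) w\<close>. Multiplying by \<open>w\<close> and integrating over \<open>{u < c}\<close>, where both
  sides of the energy identity have opposite signs because \<open>\<beta> \<ge> 0\<close>, shows that \<open>w\<close> is constant on
  vertical lines; it tends to zero at infinity, so \<open>v = 0\<close> on \<open>{u < c}\<close>. Then \<open>u\<^sub>x = -v\<^sub>y = 0\<close> there,
  hence \<open>{u < c}\<close> is a half plane \<open>{y < y0}\<close>. On the other side the energy identity has no sign, but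
  \<open>|\<Delta>v| \<le> K |v| / (y - y0)\<close> with vanishing Cauchy data on \<open>y = y0\<close>, and a Carleman estimate combined
  with Hardy's inequality yields \<open>v = 0\<close>. So the wave is a shear flow.
\<close>

section \<open>Partial derivatives and the vorticity equation\<close>

lemma dx_has_derivative:
  "C1_plane f \<Longrightarrow> ((\<lambda>s. f (s, y)) has_real_derivative dx f (x, y)) (at x)"
  unfolding C1_plane_def dx_def by (simp add: DERIV_deriv_iff_real_differentiable)

lemma dy_has_derivative:
  "C1_plane f \<Longrightarrow> ((\<lambda>s. f (x, s)) has_real_derivative dy f (x, y)) (at y)"
  unfolding C1_plane_def dy_def by (simp add: DERIV_deriv_iff_real_differentiable)

lemma dx_eqI: "((\<lambda>s. f (s, y)) has_real_derivative D) (at x) \<Longrightarrow> dx f (x, y) = D"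
  unfolding dx_def by (simp add: DERIV_imp_deriv)

lemma dy_eqI: "((\<lambda>s. f (x, s)) has_real_derivative D) (at y) \<Longrightarrow> dy f (x, y) = D"
  unfolding dy_def by (simp add: DERIV_imp_deriv)

lemma C1_plane_continuous:
  assumes "C1_plane f"
  shows "continuous_on UNIV f" "continuous_on UNIV (dx f)" "continuous_on UNIV (dy f)"
  using assms unfolding C1_plane_def by auto

text \<open>Schwarz's theorem: the mean value theorem is applied in both orders to the second
  difference over a small square. The candidate derivatives are parameters so that the pressure,
  which is only assumed \<open>C1_plane\<close>, is covered.\<close>

lemma mixed_partials_eq:
  fixes f fx fy fxy fyx :: "real \<times> real \<Rightarrow> real"
  assumes fx: "\<And>x y. ((\<lambda>s. f (s, y)) has_real_derivative fx (x, y)) (at x)"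
    and fy: "\<And>x y. ((\<lambda>s. f (x, s)) has_real_derivative fy (x, y)) (at y)"
    and fxy: "\<And>x y. ((\<lambda>s. fx (x, s)) has_real_derivative fxy (x, y)) (at y)"
    and fyx: "\<And>x y. ((\<lambda>s. fy (s, y)) has_real_derivative fyx (x, y)) (at x)"
    and cont: "continuous_on UNIV fxy" "continuous_on UNIV fyx"
  shows "fxy (x, y) = fyx (x, y)"
proof (rule ccontr)
  assume ne: "fxy (x, y) \<noteq> fyx (x, y)"
  define e where "e = \<bar>fxy (x, y) - fyx (x, y)\<bar> / 2"
  have "e > 0" using ne by (simp add: e_def)
  obtain d1 where d1: "d1 > 0" "\<And>p. dist p (x, y) < d1 \<Longrightarrow> dist (fxy p) (fxy (x, y)) < e"
    using cont(1) \<open>e > 0\<close> unfolding continuous_on_iff by (metis UNIV_I)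
  obtain d2 where d2: "d2 > 0" "\<And>p. dist p (x, y) < d2 \<Longrightarrow> dist (fyx p) (fyx (x, y)) < e"
    using cont(2) \<open>e > 0\<close> unfolding continuous_on_iff by (metis UNIV_I)
  define h where "h = min d1 d2 / 3"
  have h: "h > 0" "2 * h < d1" "2 * h < d2" using d1(1) d2(1) by (auto simp: h_def)
  have near: "dist (a, b) (x, y) < 2 * h" if "x < a" "a < x + h" "y < b" "b < y + h" for a b
  proof -
    have "dist (a, b) (x, y) \<le> \<bar>a - x\<bar> + \<bar>b - y\<bar>"
      using sqrt_sum_squares_le_sum_abs[of "a - x" "b - y"]
      by (simp add: dist_Pair_Pair dist_real_def)
    then show ?thesis using that by linarith
  qed
  obtain a where a: "x < a" "a < x + h"
    "(f (x + h, y + h) - f (x + h, y)) - (f (x, y + h) - f (x, y)) = h * (fx (a, y + h) - fx (a, y))"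
  proof -
    have "\<exists>z>x. z < x + h \<and> (f (x + h, y + h) - f (x + h, y)) - (f (x, y + h) - f (x, y))
        = (x + h - x) * (fx (z, y + h) - fx (z, y))"
      using h by (intro MVT2[of x "x + h" "\<lambda>s. f (s, y + h) - f (s, y)" "\<lambda>z. fx (z, y + h) - fx (z, y)"])
         (auto intro!: DERIV_diff fx)
    then show ?thesis using that by auto
  qed
  obtain b where b: "y < b" "b < y + h" "fx (a, y + h) - fx (a, y) = h * fxy (a, b)"
    using MVT2[of y "y + h" "\<lambda>s. fx (a, s)" "\<lambda>z. fxy (a, z)"] h fxy by auto
  obtain b' where b': "y < b'" "b' < y + h"
    "(f (x + h, y + h) - f (x, y + h)) - (f (x + h, y) - f (x, y)) = h * (fy (x + h, b') - fy (x, b'))"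
  proof -
    have "\<exists>z>y. z < y + h \<and> (f (x + h, y + h) - f (x, y + h)) - (f (x + h, y) - f (x, y))
        = (y + h - y) * (fy (x + h, z) - fy (x, z))"
      using h by (intro MVT2[of y "y + h" "\<lambda>s. f (x + h, s) - f (x, s)" "\<lambda>z. fy (x + h, z) - fy (x, z)"])
         (auto intro!: DERIV_diff fy)
    then show ?thesis using that by auto
  qed
  obtain a' where a': "x < a'" "a' < x + h" "fy (x + h, b') - fy (x, b') = h * fyx (a', b')"
    using MVT2[of x "x + h" "\<lambda>s. fy (s, b')" "\<lambda>z. fyx (z, b')"] h fyx by auto
  \<comment> \<open>Both sides are the second difference of \<open>f\<close> over the square,
    grouped by columns and by rows.\<close>
  have "h * (h * fxy (a, b)) = h * (h * fyx (a', b'))"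
    unfolding a(3)[symmetric] b(3)[symmetric] a'(3)[symmetric] b'(3)[symmetric] by simp
  then have "fxy (a, b) = fyx (a', b')" using h by simp
  moreover have "dist (fxy (a, b)) (fxy (x, y)) < e" "dist (fyx (a', b')) (fyx (x, y)) < e"
    using near[of a b] near[of a' b'] a b a' b' h by (auto intro!: d1 d2)
  ultimately have "\<bar>fxy (x, y) - fyx (x, y)\<bar> < e + e"
    unfolding dist_real_def by linarith
  then show False by (simp add: e_def dist_real_def)
qed

lemma C2_plane_mixed:
  assumes "C2_plane f"
  shows "dy (dx f) p = dx (dy f) p"
proof -
  have "C1_plane f" "C1_plane (dx f)" "C1_plane (dy f)"
    using assms by (auto simp: C2_plane_def)
  then show ?thesis
    using mixed_partials_eq[of f "dx f" "dy f" "dy (dx f)" "dx (dy f)" "fst p" "snd p"]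
    by (simp add: dx_has_derivative dy_has_derivative C1_plane_continuous)
qed

text \<open>Integrating each derivative first in its own variable leaves only the horizontal edges,
  since the vertical ones cancel by periodicity. Differentiability is asked for on the closed cell
  only, which admits weights that are singular below it.\<close>

lemma integral_divergence:
  fixes F G Fx Gy :: "real \<times> real \<Rightarrow> real"
  assumes "x1 \<le> x2" "a \<le> b"
    and F: "\<And>x y. x \<in> {x1..x2} \<Longrightarrow> y \<in> {a..b} \<Longrightarrow> ((\<lambda>s. F (s, y)) has_real_derivative Fx (x, y)) (at x)"
    and G: "\<And>x y. x \<in> {x1..x2} \<Longrightarrow> y \<in> {a..b} \<Longrightarrow> ((\<lambda>s. G (x, s)) has_real_derivative Gy (x, y)) (at y)"
    and cont: "continuous_on (cbox (x1, a) (x2, b)) Fx" "continuous_on (cbox (x1, a) (x2, b)) Gy"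
    and per: "\<And>y. F (x2, y) = F (x1, y)"
  shows "integral (cbox (x1, a) (x2, b)) (\<lambda>p. Fx p + Gy p) = integral {x1..x2} (\<lambda>x. G (x, b) - G (x, a))"
proof -
  have 1: "integral (cbox (x1, a) (x2, b)) Fx = 0"
  proof -
    have "integral (cbox (x1, a) (x2, b)) Fx = integral {x1..x2} (\<lambda>x. integral {a..b} (\<lambda>y. Fx (x, y)))"
      using integral_prod_continuous[OF cont(1)] by simp
    also have "\<dots> = integral {a..b} (\<lambda>y. integral {x1..x2} (\<lambda>x. Fx (x, y)))"
      using integral_swap_continuous[of x1 a x2 b "\<lambda>x y. Fx (x, y)"] cont(1) by simp
    also have "\<dots> = integral {a..b} (\<lambda>y. 0)"
    proof (rule integral_cong)
      fix y assume "y \<in> {a..b}"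
      then have "((\<lambda>x. Fx (x, y)) has_integral (F (x2, y) - F (x1, y))) {x1..x2}"
        using \<open>x1 \<le> x2\<close> F
        by (intro fundamental_theorem_of_calculus)
           (auto simp: has_real_derivative_iff_has_vector_derivative[symmetric]
             intro: has_field_derivative_at_within)
      then show "integral {x1..x2} (\<lambda>x. Fx (x, y)) = 0"
        using per[of y] by (simp add: integral_unique)
    qed
    finally show ?thesis by simp
  qed
  have 2: "integral (cbox (x1, a) (x2, b)) Gy = integral {x1..x2} (\<lambda>x. G (x, b) - G (x, a))"
  proof -
    have "integral (cbox (x1, a) (x2, b)) Gy = integral {x1..x2} (\<lambda>x. integral {a..b} (\<lambda>y. Gy (x, y)))"
      using integral_prod_continuous[OF cont(2)] by simp
    also have "\<dots> = integral {x1..x2} (\<lambda>x. G (x, b) - G (x, a))"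
    proof (rule integral_cong)
      fix x assume "x \<in> {x1..x2}"
      then have "((\<lambda>y. Gy (x, y)) has_integral (G (x, b) - G (x, a))) {a..b}"
        using \<open>a \<le> b\<close> G
        by (intro fundamental_theorem_of_calculus)
           (auto simp: has_real_derivative_iff_has_vector_derivative[symmetric]
             intro: has_field_derivative_at_within)
      then show "integral {a..b} (\<lambda>y. Gy (x, y)) = G (x, b) - G (x, a)"
        by (simp add: integral_unique)
    qed
    finally show ?thesis .
  qed
  show ?thesis
    using 1 2 integral_add[OF integrable_continuous[OF cont(1)] integrable_continuous[OF cont(2)]] by simp
qed

text \<open>The set where |f| exceeds \<open>M\<close> is open and null, and a nonempty open set is
  not negligible.\<close>

lemma continuous_bounded_by_Linf_norm:
  assumes cont: "continuous_on UNIV f" and le: "Linf_norm f \<le> ereal M"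
  shows "\<bar>f p\<bar> \<le> M"
proof (rule ccontr)
  assume "\<not> \<bar>f p\<bar> \<le> M"
  define S where "S = {q. M < \<bar>f q\<bar>}"
  have S: "open S" unfolding S_def
    using cont by (intro open_Collect_less continuous_intros) auto
  have "AE q in lborel. ereal \<bar>f q\<bar> \<le> esssup lborel (\<lambda>q. ereal \<bar>f q\<bar>)"
    by (rule esssup_AE)
  then have "AE q in lborel. ereal \<bar>f q\<bar> \<le> ereal M"
    by (rule eventually_mono) (metis le Linf_norm_def order_trans)
  then have "AE q in lborel. q \<notin> S" by (simp add: S_def not_less)
  then have "emeasure lborel S = 0"
    using S by (subst (asm) AE_iff_measurable[where N = S]) auto
  then have "negligible S"
    using S by (simp add: negligible_iff_emeasure0)
  moreover have "p \<in> S" using \<open>\<not> \<bar>f p\<bar> \<le> M\<close> by (simp add: S_def)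
  ultimately show False using open_not_negligible[OF S] by blast
qed

text \<open>The curl of the momentum equations at time 0 eliminates the pressure. The equations
  themselves express its gradient through \<open>C1_plane\<close> functions, so its mixed
  derivatives exist and are continuous.\<close>

lemma vorticity_equation:
  assumes u: "C2_plane u" and v: "C2_plane v" and tw: "traveling_wave_solution L \<beta> c u v"
  shows "dx u p + dy v p = 0"
    and "(u p - c) * laplacian v p + v p * (\<beta> - laplacian u p) = 0"
proof -
  obtain P where P: "beta_plane_solution L \<beta>
      (\<lambda>t p. u (fst p - c * t, snd p)) (\<lambda>t p. v (fst p - c * t, snd p)) P"
    using tw by (auto simp: traveling_wave_solution_def)
  have C1: "C1_plane u" "C1_plane v" "C1_plane (dx u)" "C1_plane (dx v)" "C1_plane (dy u)" "C1_plane (dy v)"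
    using u v by (auto simp: C2_plane_def)
  have C1P: "C1_plane (P 0)" using P by (auto simp: beta_plane_solution_def)
  \<comment> \<open>The time derivative of a traveling wave is \<open>- c * dx f\<close>, which
    turns the transport coefficient \<open>u\<close> into \<open>u - c\<close>.\<close>
  have time: "deriv (\<lambda>s. f (x - c * s, y)) 0 = - c * dx f (x, y)" if "C1_plane f" for f x y
  proof -
    have "((\<lambda>s. f (x - c * s, y)) has_real_derivative dx f (x - c * 0, y) * (- c)) (at 0)"
      by (rule DERIV_chain2[where f = "\<lambda>s. f (s, y)"])
         (auto intro!: dx_has_derivative that derivative_eq_intros)
    then show ?thesis by (simp add: DERIV_imp_deriv)
  qed
  have eqs: "deriv (\<lambda>s. u (x - c * s, y)) 0 + u (x, y) * dx u (x, y) + v (x, y) * dy u (x, y) - \<beta> * y * v (x, y)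
          = - dx (P 0) (x, y)"
        "deriv (\<lambda>s. v (x - c * s, y)) 0 + u (x, y) * dx v (x, y) + v (x, y) * dy v (x, y) + \<beta> * y * u (x, y)
          = - dy (P 0) (x, y)"
        "dx u (x, y) + dy v (x, y) = 0" for x y
  proof -
    have "deriv (\<lambda>s. u (fst p - c * s, snd p)) 0 + u (fst p - c * 0, snd p) * dx (\<lambda>p. u (fst p - c * 0, snd p)) p
        + v (fst p - c * 0, snd p) * dy (\<lambda>p. u (fst p - c * 0, snd p)) p - \<beta> * snd p * v (fst p - c * 0, snd p)
          = - dx (P 0) p \<and>
        deriv (\<lambda>s. v (fst p - c * s, snd p)) 0 + u (fst p - c * 0, snd p) * dx (\<lambda>p. v (fst p - c * 0, snd p)) p
        + v (fst p - c * 0, snd p) * dy (\<lambda>p. v (fst p - c * 0, snd p)) p + \<beta> * snd p * u (fst p - c * 0, snd p)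
          = - dy (P 0) p \<and>
        dx (\<lambda>p. u (fst p - c * 0, snd p)) p + dy (\<lambda>p. v (fst p - c * 0, snd p)) p = 0" for p
      using P unfolding beta_plane_solution_def by blast
    from this[of "(x, y)"]
    show "deriv (\<lambda>s. u (x - c * s, y)) 0 + u (x, y) * dx u (x, y) + v (x, y) * dy u (x, y) - \<beta> * y * v (x, y)
          = - dx (P 0) (x, y)"
        "deriv (\<lambda>s. v (x - c * s, y)) 0 + u (x, y) * dx v (x, y) + v (x, y) * dy v (x, y) + \<beta> * y * u (x, y)
          = - dy (P 0) (x, y)"
        "dx u (x, y) + dy v (x, y) = 0"
      by simp_all
  qed
  have div: "dx u q + dy v q = 0" for q using eqs(3) by (cases q) auto
  then show "dx u p + dy v p = 0" .
  have div': "dx u = (\<lambda>q. - dy v q)" "dy v = (\<lambda>q. - dx u q)"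
    using div by (auto simp: fun_eq_iff add_eq_0_iff add_eq_0_iff2)
  have Px: "dx (P 0) (x, y) = - ((u (x, y) - c) * dx u (x, y) + v (x, y) * dy u (x, y) - \<beta> * y * v (x, y))" for x y
    using eqs(1)[of x y] time[OF C1(1), of x y] by (simp add: algebra_simps)
  have Py: "dy (P 0) (x, y) = - ((u (x, y) - c) * dx v (x, y) + v (x, y) * dy v (x, y) + \<beta> * y * u (x, y))" for x y
    using eqs(2)[of x y] time[OF C1(2), of x y] by (simp add: algebra_simps)
  define Pxy where "Pxy q = - (dy u q * dx u q + (u q - c) * dy (dx u) q + dy v q * dy u q + v q * dy (dy u) q
    - (\<beta> * v q + \<beta> * snd q * dy v q))" for q
  define Pyx where "Pyx q = - (dx u q * dx v q + (u q - c) * dx (dx v) q + dx v q * dy v q + v q * dx (dy v) q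
    + \<beta> * snd q * dx u q)" for q
  have "Pxy (fst p, snd p) = Pyx (fst p, snd p)"
  proof (rule mixed_partials_eq)
    show "((\<lambda>s. P 0 (s, y)) has_real_derivative dx (P 0) (x, y)) (at x)" for x y
      by (rule dx_has_derivative[OF C1P])
    show "((\<lambda>s. P 0 (x, s)) has_real_derivative dy (P 0) (x, y)) (at y)" for x y
      by (rule dy_has_derivative[OF C1P])
    show "((\<lambda>s. dx (P 0) (x, s)) has_real_derivative Pxy (x, y)) (at y)" for x y
      unfolding Px Pxy_def using C1
      by (auto intro!: derivative_eq_intros dy_has_derivative simp: algebra_simps)
    show "((\<lambda>s. dy (P 0) (s, y)) has_real_derivative Pyx (x, y)) (at x)" for x y
      unfolding Py Pyx_def using C1
      by (auto intro!: derivative_eq_intros dx_has_derivative simp: algebra_simps)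
    show "continuous_on UNIV Pxy" unfolding Pxy_def
      using C1 by (intro continuous_intros C1_plane_continuous) 
    show "continuous_on UNIV Pyx" unfolding Pyx_def
      using C1 by (intro continuous_intros C1_plane_continuous)
  qed
  \<comment> \<open>Differentiated incompressibility turns the mixed derivatives into the second
    derivatives still missing from the two Laplacians.\<close>
  moreover have "dy (dx u) p = - dy (dy v) p"
    unfolding div'(1) by (cases p) (auto intro!: dy_eqI DERIV_minus dy_has_derivative C1)
  moreover have "dx (dy v) p = - dx (dx u) p"
    unfolding div'(2) by (cases p) (auto intro!: dx_eqI DERIV_minus dx_has_derivative C1)
  moreover have "dy v p = - dx u p" using div[of p] by simp
  ultimately show "(u p - c) * laplacian v p + v p * (\<beta> - laplacian u p) = 0"
    by (simp add: Pxy_def Pyx_def laplacian_def algebra_simps)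
qed

lemma continuous_on_slice:
  fixes f :: "real \<times> real \<Rightarrow> real"
  assumes "continuous_on UNIV f"
  shows "continuous_on A (\<lambda>x. f (x, y))" "continuous_on A (\<lambda>y. f (x, y))"
  by (rule continuous_on_compose2[OF assms]; auto intro!: continuous_intros)+

section \<open>Carleman estimate and unique continuation\<close>

lemma x_periodic_dx: "x_periodic L f \<Longrightarrow> C1_plane f \<Longrightarrow> x_periodic L (dx f)"
  unfolding x_periodic_def
proof (intro allI)
  fix x y assume per: "\<forall>x y. f (x + L, y) = f (x, y)" and C: "C1_plane f"
  have "((\<lambda>s. f (s + L, y)) has_real_derivative dx f (x + L, y)) (at x)"
    using dx_has_derivative[OF C, of y "x + L"] by (simp add: DERIV_shift)
  then show "dx f (x + L, y) = dx f (x, y)"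
    using per by (simp add: dx_eqI)
qed

lemma x_periodic_dy: "x_periodic L f \<Longrightarrow> x_periodic L (dy f)"
  unfolding x_periodic_def dy_def by simp

text \<open>
  Write \<open>z = e\<^sup>\<phi> v\<close> with \<open>\<phi> = \<tau> (y - Y)\<^sup>2 / 2\<close> and \<open>p = \<phi>'\<close>, \<open>s = e\<^sup>-\<^sup>\<phi> z\<^sub>y\<close>. The conjugated
  Laplacian of \<open>z\<close> splits into a symmetric part \<open>A\<close> and a skew part \<open>B\<close>, and twice the product of
  the two is a divergence plus \<open>4 \<tau> (s\<^sup>2 + p\<^sup>2 v\<^sup>2)\<close>. The square \<open>4 \<tau> (s - v q / 2)\<^sup>2\<close> is Hardy's
  inequality in pointwise form, with \<open>q = 1 / (y - y0)\<close>.
\<close>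

lemma carleman_algebra:
  fixes p q s \<tau> v vx vxx vxy vy vyy :: real
  assumes "\<tau> \<ge> 0" "s = vy + p * v"
  defines "sy \<equiv> vyy + \<tau> * v + p * vy"
  shows "- 4 * p * (vxx * s + vx * (vxy + p * vx)) - 2 * \<tau> * (vx * vx + v * vxx)
    + (2 * p * (2 * p * vx\<^sup>2 - 2 * p * s\<^sup>2 - 2 * \<tau> * v * s - 2 * p ^ 3 * v\<^sup>2 + 2 * \<tau> * (v\<^sup>2 * q))
       + (2 * \<tau> * vx\<^sup>2 + 4 * p * vx * vxy - 2 * \<tau> * s\<^sup>2 - 4 * p * s * sy - 2 * \<tau> * vy * s - 2 * \<tau> * v * sy
          - 6 * \<tau> * p\<^sup>2 * v\<^sup>2 - 4 * p ^ 3 * v * vy + 2 * \<tau> * (2 * v * vy * q - v\<^sup>2 * q\<^sup>2)))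
    \<le> (vxx + vyy)\<^sup>2 - \<tau> * v\<^sup>2 * q\<^sup>2"
proof -
  \<comment> \<open>The symmetric part \<open>?A\<close> and the skew part \<open>?B\<close> add up
    to \<open>vxx + vyy\<close>, so expanding its square leaves twice their product for the
    divergence to absorb.\<close>
  let ?A = "vxx + vyy + \<tau> * v + 2 * p * vy + 2 * p\<^sup>2 * v" 
  let ?B = "- 2 * p * s - \<tau> * v"
  have "(vxx + vyy)\<^sup>2 - \<tau> * v\<^sup>2 * q\<^sup>2 - (- 4 * p * (vxx * s + vx * (vxy + p * vx)) - 2 * \<tau> * (vx * vx + v * vxx)
    + (2 * p * (2 * p * vx\<^sup>2 - 2 * p * s\<^sup>2 - 2 * \<tau> * v * s - 2 * p ^ 3 * v\<^sup>2 + 2 * \<tau> * (v\<^sup>2 * q))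
       + (2 * \<tau> * vx\<^sup>2 + 4 * p * vx * vxy - 2 * \<tau> * s\<^sup>2 - 4 * p * s * sy - 2 * \<tau> * vy * s - 2 * \<tau> * v * sy
          - 6 * \<tau> * p\<^sup>2 * v\<^sup>2 - 4 * p ^ 3 * v * vy + 2 * \<tau> * (2 * v * vy * q - v\<^sup>2 * q\<^sup>2))))
    = (?A\<^sup>2 + ?B\<^sup>2) + 4 * \<tau> * (s - v * q / 2)\<^sup>2 + 4 * \<tau> * p\<^sup>2 * v\<^sup>2"
    unfolding assms(2) sy_def by (simp add: power2_eq_square power3_eq_cube field_simps)
  moreover have "\<dots> \<ge> 0" using assms(1) by simp
  ultimately show ?thesis by linarith
qed

lemma dy_bounded_imp_lipschitz:
  assumes "C1_plane f" "\<And>p. \<bar>dy f p\<bar> \<le> M"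
  shows "\<bar>f (x, y) - f (x, y')\<bar> \<le> M * \<bar>y - y'\<bar>"
  using field_differentiable_bound[of UNIV "\<lambda>s. f (x, s)" "\<lambda>s. dy f (x, s)" M y y'] assms
  by (auto intro: dy_has_derivative)

lemma dx_bounded_imp_lipschitz:
  assumes "C1_plane f" "\<And>p. \<bar>dx f p\<bar> \<le> M"
  shows "\<bar>f (x, y) - f (x', y)\<bar> \<le> M * \<bar>x - x'\<bar>"
  using field_differentiable_bound[of UNIV "\<lambda>s. f (s, y)" "\<lambda>s. dx f (s, y)" M x x'] assms
  by (auto intro: dx_has_derivative)

text \<open>
  The weight has zero slope at the top \<open>y = Y\<close>, so that the boundary term there does not grow
  exponentially in \<open>\<tau>\<close> and no cutoff is needed.
\<close>

lemma carleman_estimate: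
  fixes v :: "real \<times> real \<Rightarrow> real"
  assumes "L > 0" and C2: "C2_plane v" and per: "x_periodic L v"
    and zero: "\<And>x y. y \<le> y0 \<Longrightarrow> v (x, y) = 0"
    and M: "\<And>p. \<bar>dx v p\<bar> \<le> M" "\<And>p. \<bar>dy v p\<bar> \<le> M"
    and "y0 < a" "a < Y" "\<tau> \<ge> 2 * K\<^sup>2" "\<tau> \<ge> 0"
    and K: "\<And>x y. x \<in> {x0..x0 + L} \<Longrightarrow> y \<in> {y0<..Y} \<Longrightarrow> \<bar>laplacian v (x, y)\<bar> * (y - y0) \<le> K * \<bar>v (x, y)\<bar>"
  shows "integral (cbox (x0, a) (x0 + L, Y))
      (\<lambda>p. \<tau> / 2 * (exp (\<tau> * (snd p - Y)\<^sup>2) * ((v p)\<^sup>2 / (snd p - y0)\<^sup>2))) \<le> 2 * \<tau> * M\<^sup>2 * (Y - y0) * L"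
proof -
  have C1: "C1_plane v" "C1_plane (dx v)" "C1_plane (dy v)" using C2 by (auto simp: C2_plane_def)
  have "M \<ge> 0" using M(1)[of undefined] by linarith
  note Dx = dx_has_derivative[OF C1(1)] dx_has_derivative[OF C1(2)] dx_has_derivative[OF C1(3)]
  note Dy = dy_has_derivative[OF C1(1)] dy_has_derivative[OF C1(2)] dy_has_derivative[OF C1(3)]
  have cont [THEN continuous_on_subset, continuous_intros]: "continuous_on UNIV v" "continuous_on UNIV (dx v)" "continuous_on UNIV (dy v)"
    "continuous_on UNIV (dx (dx v))" "continuous_on UNIV (dy (dx v))" "continuous_on UNIV (dx (dy v))" "continuous_on UNIV (dy (dy v))"
    using C1 by (auto simp: C1_plane_continuous)
  \<comment> \<open>In the notation of \<open>carleman_algebra\<close>, \<open>P\<close> is p,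
    \<open>S\<close> is s and 1 / \<open>h\<close> is q; \<open>E\<close> is the squared weight exp
    (2 \<phi>).\<close>
  define P where "P p = \<tau> * (snd p - Y)" for p :: "real \<times> real"
  define E where "E p = exp (\<tau> * (snd p - Y)\<^sup>2)" for p :: "real \<times> real"
  define S where "S p = dy v p + P p * v p" for p
  define h where "h p = snd p - y0" for p :: "real \<times> real"
  define Sx where "Sx p = dx (dy v) p + P p * dx v p" for p
  define Sy where "Sy p = dy (dy v) p + \<tau> * v p + P p * dy v p" for p
  \<comment> \<open>\<open>F\<close> and \<open>G\<close> are the components of the flux, the
    quotient by \<open>h\<close> being its Hardy part. \<open>Fx\<close> + \<open>Gy\<close> is
    \<open>E\<close> times the divergence expression of \<open>carleman_algebra\<close>.\<close>
  define F where "F p = E p * (- 4 * P p * dx v p * S p - 2 * \<tau> * v p * dx v p)" for p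
  define I where "I p = 2 * P p * (dx v p)\<^sup>2 - 2 * P p * (S p)\<^sup>2 - 2 * \<tau> * v p * S p - 2 * P p ^ 3 * (v p)\<^sup>2" for p
  define G where "G p = E p * (I p + 2 * \<tau> * ((v p)\<^sup>2 / h p))" for p
  define Fx where "Fx p = E p * (- 4 * P p * (dx (dx v) p * S p + dx v p * Sx p)
      - 2 * \<tau> * (dx v p * dx v p + v p * dx (dx v) p))" for p
  define Gy where "Gy p = E p * (2 * P p * (I p + 2 * \<tau> * ((v p)\<^sup>2 / h p))
      + (2 * \<tau> * (dx v p)\<^sup>2 + 4 * P p * dx v p * dy (dx v) p - 2 * \<tau> * (S p)\<^sup>2 - 4 * P p * S p * Sy p
         - 2 * \<tau> * dy v p * S p - 2 * \<tau> * v p * Sy p - 6 * \<tau> * (P p)\<^sup>2 * (v p)\<^sup>2 - 4 * P p ^ 3 * v p * dy v p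
         + 2 * \<tau> * (2 * v p * dy v p / h p - (v p)\<^sup>2 / (h p)\<^sup>2)))" for p
  define f where "f p = \<tau> / 2 * (E p * ((v p)\<^sup>2 / (h p)\<^sup>2))" for p
  \<comment> \<open>Half of the Hardy gain absorbs the squared Laplacian, because \<tau> \<ge> 2
    K^2.\<close>
  have bound: "Fx p + Gy p \<le> - f p" if p: "p \<in> cbox (x0, b) (x0 + L, Y)" "b > y0" for p b
  proof -
    obtain x y where xy: "p = (x, y)" "x \<in> {x0..x0 + L}" "y \<in> {y0<..Y}"
      using p by (cases p) (auto simp: cbox_Pair_eq)
    define q where "q = 1 / h p"
    have "h p > 0" using xy by (simp add: h_def)
    have "\<bar>laplacian v p\<bar> \<le> K * \<bar>v p\<bar> * q"
      using K[OF xy(2,3)] \<open>h p > 0\<close> unfolding xy(1) q_def h_def by (simp add: field_simps)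
    then have "(laplacian v p)\<^sup>2 \<le> (K * \<bar>v p\<bar> * q)\<^sup>2"
      by (intro power2_le_iff_abs_le[THEN iffD2]) (auto intro: order_trans[OF abs_ge_zero])
    also have "\<dots> = K\<^sup>2 * ((v p)\<^sup>2 * q\<^sup>2)" by (simp add: power_mult_distrib)
    also have "\<dots> \<le> \<tau> / 2 * ((v p)\<^sup>2 * q\<^sup>2)"
      using \<open>\<tau> \<ge> 2 * K\<^sup>2\<close> by (intro mult_right_mono) auto
    finally have lap: "(laplacian v p)\<^sup>2 \<le> \<tau> / 2 * ((v p)\<^sup>2 * q\<^sup>2)" .
    have "Fx p + Gy p \<le> E p * ((laplacian v p)\<^sup>2 - \<tau> * (v p)\<^sup>2 * q\<^sup>2)"
      using carleman_algebra[OF \<open>\<tau> \<ge> 0\<close>, of "S p" "dy v p" "P p" "v p" "dx (dx v) p" "dx v p" "dy (dx v) p" q "dy (dy v) p"]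
      unfolding Fx_def Gy_def distrib_left[symmetric]
      by (intro mult_left_mono)
         (simp_all add: E_def S_def Sx_def Sy_def I_def laplacian_def q_def power_divide C2_plane_mixed[OF C2] mult.assoc)
    also have "\<dots> \<le> E p * (- (\<tau> / 2 * ((v p)\<^sup>2 * q\<^sup>2)))"
      using lap by (intro mult_left_mono) (auto simp: E_def)
    finally show ?thesis by (simp add: f_def q_def power_divide algebra_simps)
  qed
  have contE: "continuous_on A E" "continuous_on A P" "continuous_on A h" for A
    unfolding E_def P_def h_def by (auto intro!: continuous_intros)
  have contS: "continuous_on A S" "continuous_on A Sx" "continuous_on A Sy" for A
    unfolding S_def Sx_def Sy_def by (auto intro!: continuous_intros contE)
  have contI: "continuous_on A I" for A
    unfolding I_def by (auto intro!: continuous_intros contE contS)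
  have cG1: "(\<lambda>x. G (x, y)) integrable_on {x0..x0 + L}" if "y > y0" for y
    unfolding G_def using that
    by (intro integrable_continuous_interval)
      (auto intro!: continuous_intros continuous_on_compose2[OF contE(1)] continuous_on_compose2[OF contE(3)]
        continuous_on_compose2[OF contI] continuous_on_compose2[OF cont(1)] simp: h_def)
  \<comment> \<open>The divergence theorem is used from a height \<open>b\<close> above
    \<open>y0\<close>, where 1 / \<open>h\<close> is continuous. As \<open>f\<close> is nonnegative,
    its integral can be kept on the fixed cell from \<open>a\<close> while \<open>b\<close> tends to
    \<open>y0\<close>.\<close>
  have key: "integral (cbox (x0, a) (x0 + L, Y)) f
      \<le> integral {x0..x0 + L} (\<lambda>x. G (x, b)) - integral {x0..x0 + L} (\<lambda>x. G (x, Y))"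
    if b: "y0 < b" "b < a" for b
  proof -
    have cFx: "continuous_on (cbox (x0, b) (x0 + L, Y)) Fx" unfolding Fx_def
      by (auto intro!: continuous_intros contE contS)
    have cGy: "continuous_on (cbox (x0, b) (x0 + L, Y)) Gy" unfolding Gy_def
      using b by (auto intro!: continuous_intros contE contS contI simp: h_def)
    have cf: "continuous_on (cbox (x0, b) (x0 + L, Y)) f" unfolding f_def
      using b by (auto intro!: continuous_intros contE contS contI simp: h_def)
    have div: "integral (cbox (x0, b) (x0 + L, Y)) (\<lambda>p. Fx p + Gy p)
        = integral {x0..x0 + L} (\<lambda>x. G (x, Y) - G (x, b))"
    proof (rule integral_divergence[OF _ _ _ _ cFx cGy])
      show "((\<lambda>s. F (s, y)) has_real_derivative Fx (x, y)) (at x)" for x y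
        unfolding F_def Fx_def E_def P_def S_def Sx_def
        by (auto intro!: derivative_eq_intros Dx simp: algebra_simps)
      show "((\<lambda>s. G (x, s)) has_real_derivative Gy (x, y)) (at y)" if "y \<in> {b..Y}" for x y
      proof -
        have "h (x, y) \<noteq> 0" using that b by (auto simp: h_def)
        have DP: "((\<lambda>s. P (x, s)) has_real_derivative \<tau>) (at y)"
          unfolding P_def by (auto intro!: derivative_eq_intros)
        have DE: "((\<lambda>s. E (x, s)) has_real_derivative E (x, y) * (2 * P (x, y))) (at y)"
          unfolding E_def P_def by (auto intro!: derivative_eq_intros)
        have DS: "((\<lambda>s. S (x, s)) has_real_derivative Sy (x, y)) (at y)"
          unfolding S_def Sy_def by (auto intro!: derivative_eq_intros Dy DP)
        have Dh: "((\<lambda>s. (v (x, s))\<^sup>2 / h (x, s)) has_real_derivative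
            2 * v (x, y) * dy v (x, y) / h (x, y) - (v (x, y))\<^sup>2 / (h (x, y))\<^sup>2) (at y)"
        proof -
          have "((\<lambda>s. (v (x, s))\<^sup>2 / h (x, s)) has_real_derivative
              (2 * v (x, y) * dy v (x, y) * h (x, y) - (v (x, y))\<^sup>2 * 1) / (h (x, y) * h (x, y))) (at y)"
            using \<open>h (x, y) \<noteq> 0\<close>
            by (intro DERIV_divide) (auto intro!: derivative_eq_intros Dy simp: h_def)
          then show ?thesis
            using \<open>h (x, y) \<noteq> 0\<close> by (simp add: diff_divide_distrib power2_eq_square)
        qed
        have DI: "((\<lambda>s. I (x, s)) has_real_derivative
            2 * \<tau> * (dx v (x, y))\<^sup>2 + 4 * P (x, y) * dx v (x, y) * dy (dx v) (x, y) - 2 * \<tau> * (S (x, y))\<^sup>2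
            - 4 * P (x, y) * S (x, y) * Sy (x, y) - 2 * \<tau> * dy v (x, y) * S (x, y) - 2 * \<tau> * v (x, y) * Sy (x, y)
            - 6 * \<tau> * (P (x, y))\<^sup>2 * (v (x, y))\<^sup>2 - 4 * P (x, y) ^ 3 * v (x, y) * dy v (x, y)) (at y)"
          unfolding I_def
          by (auto intro!: derivative_eq_intros Dy DP DS simp: algebra_simps power2_eq_square power3_eq_cube)
        show ?thesis unfolding G_def Gy_def
          by (rule DERIV_cong[OF DERIV_mult[OF DE DERIV_add[OF DI DERIV_cmult[OF Dh]]]]) (simp add: algebra_simps)
      qed
      show "F (x0 + L, y) = F (x0, y)" for y
        using per x_periodic_dx[OF per C1(1)] x_periodic_dy[OF per]
        by (simp add: F_def E_def P_def S_def x_periodic_def)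
    qed (use \<open>L > 0\<close> b \<open>a < Y\<close> in auto)
    have "integral (cbox (x0, a) (x0 + L, Y)) f \<le> integral (cbox (x0, b) (x0 + L, Y)) f"
    proof (rule integral_subset_le)
      show "f integrable_on cbox (x0, b) (x0 + L, Y)" by (rule integrable_continuous[OF cf])
      show sub: "cbox (x0, a) (x0 + L, Y) \<subseteq> cbox (x0, b) (x0 + L, Y)"
        using b by (auto simp: cbox_Pair_eq)
      show "f integrable_on cbox (x0, a) (x0 + L, Y)"
        by (rule integrable_continuous[OF continuous_on_subset[OF cf sub]])
      show "\<forall>p\<in>cbox (x0, b) (x0 + L, Y). 0 \<le> f p"
        using \<open>\<tau> \<ge> 0\<close> by (auto simp: f_def E_def)
    qed
    also have "\<dots> \<le> integral (cbox (x0, b) (x0 + L, Y)) (\<lambda>p. - (Fx p + Gy p))"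
      using bound[OF _ b(1)]
      by (intro integral_le integrable_continuous cf continuous_intros cFx cGy) force+
    also have "\<dots> = - integral {x0..x0 + L} (\<lambda>x. G (x, Y) - G (x, b))"
      by (simp only: integral_neg div)
    also have "\<dots> = integral {x0..x0 + L} (\<lambda>x. G (x, b)) - integral {x0..x0 + L} (\<lambda>x. G (x, Y))"
      using b \<open>a < Y\<close> by (subst integral_diff) (auto intro!: cG1)
    finally show ?thesis .
  qed

  have vM: "\<bar>v (x, y)\<bar> \<le> M * (y - y0)" if "y \<ge> y0" for x y
    using dy_bounded_imp_lipschitz[OF C1(1) M(2), of x y y0] zero[of y0 x] that by simp
  \<comment> \<open>The Lipschitz bound tames the singular Hardy flux: it is dominated by a
    continuous function that vanishes on y = y0.\<close>
  have quot: "\<bar>(v (x, y))\<^sup>2 / h (x, y)\<bar> \<le> M * \<bar>v (x, y)\<bar>" if "y > y0" for x y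
  proof -
    have "(v (x, y))\<^sup>2 \<le> M * (y - y0) * \<bar>v (x, y)\<bar>"
      using mult_right_mono[OF vM[of y x], of "\<bar>v (x, y)\<bar>"] that by (simp add: power2_eq_square)
    then show ?thesis using that by (simp add: h_def field_simps)
  qed
  have GY: "- G (x, Y) \<le> 2 * \<tau> * M\<^sup>2 * (Y - y0)" for x
  proof -
    \<comment> \<open>At the top the weight is 1 and its slope \<open>P\<close> is 0, and the Hardy
      part of the flux has the favourable sign.\<close>
    have 1: "- G (x, Y) \<le> 2 * \<tau> * (v (x, Y) * dy v (x, Y))"
      using \<open>\<tau> \<ge> 0\<close> \<open>y0 < a\<close> \<open>a < Y\<close> by (simp add: G_def E_def I_def P_def S_def h_def)
    have 2: "v (x, Y) * dy v (x, Y) \<le> (M * (Y - y0)) * M"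
    proof -
      have "\<bar>v (x, Y)\<bar> * \<bar>dy v (x, Y)\<bar> \<le> (M * (Y - y0)) * M"
        using vM[of Y x] M(2)[of "(x, Y)"] \<open>y0 < a\<close> \<open>a < Y\<close> \<open>M \<ge> 0\<close> by (intro mult_mono) auto
      then show ?thesis using abs_ge_self[of "v (x, Y) * dy v (x, Y)"] unfolding abs_mult by linarith
    qed
    have "2 * \<tau> * (v (x, Y) * dy v (x, Y)) \<le> 2 * \<tau> * ((M * (Y - y0)) * M)"
      using \<open>\<tau> \<ge> 0\<close> by (intro mult_left_mono 2) auto
    also have "\<dots> = 2 * \<tau> * M\<^sup>2 * (Y - y0)" by (simp add: power2_eq_square)
    finally show ?thesis using 1 by linarith
  qed
  \<comment> \<open>The factor 1/2 keeps \<open>b 0\<close> strictly below \<open>a\<close>.\<close>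
  define b where "b n = y0 + (a - y0) * inverse (real (Suc n)) / 2" for n
  have b: "y0 < b n" "b n < a" for n
  proof -
    have "0 < inverse (real (Suc n))" "inverse (real (Suc n)) \<le> 1" by (auto simp: field_simps)
    then have "(a - y0) * 0 < (a - y0) * inverse (real (Suc n))" "(a - y0) * inverse (real (Suc n)) < (a - y0) * 2"
      using \<open>y0 < a\<close> by (intro mult_strict_left_mono; simp)+
    then show "y0 < b n" "b n < a" unfolding b_def by (simp_all add: field_simps)
  qed
  have "b \<longlonglongrightarrow> y0 + (a - y0) * 0 / 2"
    unfolding b_def by (intro tendsto_intros LIMSEQ_inverse_real_of_nat) auto
  then have b_lim: "b \<longlonglongrightarrow> y0" by simp
  have "(\<lambda>n. integral {x0..x0 + L} (\<lambda>x. G (x, b n))) \<longlonglongrightarrow> integral {x0..x0 + L} (\<lambda>x. 0)"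
  proof -
    let ?B = "cbox (x0, y0) (x0 + L, Y)"
    \<comment> \<open>With M |v| in place of v^2 / \<open>h\<close> the majorant is continuous down
      to \<open>y0\<close>, hence bounded on the closed cell.\<close>
    have "compact ((\<lambda>p. \<bar>E p * I p\<bar> + \<bar>E p * (2 * \<tau> * (M * \<bar>v p\<bar>))\<bar>) ` ?B)"
      by (intro compact_continuous_image continuous_intros contE contI) auto
    then have "bdd_above ((\<lambda>p. \<bar>E p * I p\<bar> + \<bar>E p * (2 * \<tau> * (M * \<bar>v p\<bar>))\<bar>) ` ?B)"
      by (intro bounded_imp_bdd_above compact_imp_bounded)
    then obtain C where C: "\<And>p. p \<in> ?B \<Longrightarrow> \<bar>E p * I p\<bar> + \<bar>E p * (2 * \<tau> * (M * \<bar>v p\<bar>))\<bar> \<le> C"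
      unfolding bdd_above_def by blast
    have G_le: "\<bar>G (x, y)\<bar> \<le> \<bar>E (x, y) * I (x, y)\<bar> + \<bar>E (x, y) * (2 * \<tau> * (M * \<bar>v (x, y)\<bar>))\<bar>" if "y > y0" for x y
    proof -
      have "\<bar>E (x, y) * (2 * \<tau> * ((v (x, y))\<^sup>2 / h (x, y)))\<bar> \<le> \<bar>E (x, y) * (2 * \<tau> * (M * \<bar>v (x, y)\<bar>))\<bar>"
        unfolding abs_mult using quot[OF that, of x] \<open>M \<ge> 0\<close>
        by (intro mult_left_mono) (auto simp: abs_mult)
      then show ?thesis unfolding G_def distrib_left by linarith
    qed
    show ?thesis
    proof (rule dominated_convergence(2))
      show "(\<lambda>x. G (x, b n)) integrable_on {x0..x0 + L}" for n by (rule cG1[OF b(1)])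
      show "(\<lambda>x. C) integrable_on {x0..x0 + L}" by auto
      show "norm (G (x, b n)) \<le> C" if "x \<in> {x0..x0 + L}" for n x
        using order_trans[OF G_le C] b[of n] that \<open>a < Y\<close> by (auto simp: cbox_Pair_eq)
      show "(\<lambda>n. G (x, b n)) \<longlonglongrightarrow> 0" if "x \<in> {x0..x0 + L}" for x
      proof (rule Lim_null_comparison)
        show "\<forall>\<^sub>F n in sequentially. norm (G (x, b n)) \<le> \<bar>E (x, b n) * I (x, b n)\<bar> + \<bar>E (x, b n) * (2 * \<tau> * (M * \<bar>v (x, b n)\<bar>))\<bar>"
          using G_le b by auto
        have along: "(\<lambda>n. f (x, t n)) \<longlonglongrightarrow> f (x, y0)" if "continuous_on UNIV f" "t \<longlonglongrightarrow> y0"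
          for f :: "real \<times> real \<Rightarrow> real" and t :: "nat \<Rightarrow> real"
          using that(1) by (rule continuous_on_tendsto_compose) (auto intro!: tendsto_intros that(2))
        have v0: "v (x, y0) = 0" by (rule zero) simp
        have "dx v (x, y0) = 0" using zero by (auto intro!: dx_eqI)
        moreover have "dy v (x, y0) = 0"
        proof -
          \<comment> \<open>\<open>v\<close> is identically zero below the line, so
            \<open>dy v\<close> on it is found as a limit from below.\<close>
          have "(\<lambda>n. y0 - inverse (real (Suc n))) \<longlonglongrightarrow> y0 - 0"
            by (intro tendsto_intros LIMSEQ_inverse_real_of_nat)
          then have "(\<lambda>n. dy v (x, y0 - inverse (real (Suc n)))) \<longlonglongrightarrow> dy v (x, y0)"
            unfolding diff_zero by (intro along cont subset_UNIV)
          moreover have "dy v (x, y0 - inverse (real (Suc n))) = 0" for n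
          proof (rule dy_eqI)
            show "((\<lambda>s. v (x, s)) has_real_derivative 0) (at (y0 - inverse (real (Suc n))))"
              by (rule has_field_derivative_transform_within_open[of "\<lambda>s. 0" _ _ "{..<y0}"]) (auto simp: zero)
          qed
          ultimately show ?thesis by (simp add: LIMSEQ_const_iff)
        qed
        ultimately have "I (x, y0) = 0" using v0 by (simp add: I_def S_def)
        then have 0: "\<bar>E (x, y0) * I (x, y0)\<bar> + \<bar>E (x, y0) * (2 * \<tau> * (M * \<bar>v (x, y0)\<bar>))\<bar> = 0"
          using v0 by simp
        have "continuous_on UNIV (\<lambda>p. \<bar>E p * I p\<bar> + \<bar>E p * (2 * \<tau> * (M * \<bar>v p\<bar>))\<bar>)"
          by (auto intro!: continuous_intros contE contI)
        from along[OF this b_lim]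
        show "(\<lambda>n. \<bar>E (x, b n) * I (x, b n)\<bar> + \<bar>E (x, b n) * (2 * \<tau> * (M * \<bar>v (x, b n)\<bar>))\<bar>) \<longlonglongrightarrow> 0"
          unfolding 0 .
      qed
    qed
  qed
  then have "(\<lambda>n. integral {x0..x0 + L} (\<lambda>x. G (x, b n)) - integral {x0..x0 + L} (\<lambda>x. G (x, Y)))
      \<longlonglongrightarrow> 0 - integral {x0..x0 + L} (\<lambda>x. G (x, Y))"
    by (intro tendsto_diff) auto
  then have "integral (cbox (x0, a) (x0 + L, Y)) f \<le> - integral {x0..x0 + L} (\<lambda>x. G (x, Y))"
    using key[OF b] by (intro LIMSEQ_le_const) auto
  also have "\<dots> = integral {x0..x0 + L} (\<lambda>x. - G (x, Y))" by simp
  also have "\<dots> \<le> integral {x0..x0 + L} (\<lambda>x. 2 * \<tau> * M\<^sup>2 * (Y - y0))"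
    using cG1[of Y] \<open>y0 < a\<close> \<open>a < Y\<close> GY by (intro integral_le integrable_neg) auto
  also have "\<dots> = 2 * \<tau> * M\<^sup>2 * (Y - y0) * L" using \<open>L > 0\<close> by simp
  finally show ?thesis unfolding f_def E_def h_def .
qed

text \<open>If \<open>v\<close> were nonzero at height \<open>y1\<close>, the weighted integral
  would be at least a constant times \<tau> exp \<tau>, whereas the Carleman bound is linear in
  \<tau>.\<close>

lemma carleman_unique_continuation:
  fixes v :: "real \<times> real \<Rightarrow> real"
  assumes "L > 0" and C2: "C2_plane v" and per: "x_periodic L v"
    and zero: "\<And>x y. y \<le> y0 \<Longrightarrow> v (x, y) = 0"
    and M: "\<And>p. \<bar>dx v p\<bar> \<le> M" "\<And>p. \<bar>dy v p\<bar> \<le> M"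
    and K: "\<And>x0 Y. \<exists>K. \<forall>x\<in>{x0..x0 + L}. \<forall>y\<in>{y0<..Y}. \<bar>laplacian v (x, y)\<bar> * (y - y0) \<le> K * \<bar>v (x, y)\<bar>"
  shows "v p = 0"
proof (rule ccontr)
  assume "v p \<noteq> 0"
  obtain x0 y1 where p: "p = (x0, y1)" by (cases p)
  have "y1 > y0" using zero[of y1 x0] \<open>v p \<noteq> 0\<close> p by force
  \<comment> \<open>Points up to height \<open>y1 + 1\<close> then have distance at least 1 from the
    top, so that the weight is at least \<open>exp \<tau>\<close> there.\<close>
  define Y where "Y = y1 + 2"
  define a where "a = (y0 + y1) / 2"
  have a: "y0 < a" "a < y1" using \<open>y1 > y0\<close> by (auto simp: a_def)
  obtain K where K: "\<And>x y. x \<in> {x0..x0 + L} \<Longrightarrow> y \<in> {y0<..Y} \<Longrightarrow> \<bar>laplacian v (x, y)\<bar> * (y - y0) \<le> K * \<bar>v (x, y)\<bar>"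
    using K by blast
  define f where "f p = (v p)\<^sup>2 / (snd p - y0)\<^sup>2" for p
  define B where "B = cbox (x0, a) (x0 + L, y1 + 1)"
  have contv: "continuous_on S v" for S
    using C2 unfolding C2_plane_def by (blast intro: C1_plane_continuous continuous_on_subset)
  have cf: "continuous_on (cbox (x0, a) (x0 + L, t)) f" for t
    unfolding f_def using a by (intro continuous_intros contv) (auto simp: cbox_Pair_eq)
  define \<kappa> where "\<kappa> = integral B f"
  have "\<kappa> \<ge> 0" unfolding \<kappa>_def B_def
    by (intro integral_nonneg integrable_continuous cf) (simp add: f_def)
  moreover have "\<kappa> \<noteq> 0"
  proof
    assume "\<kappa> = 0"
    \<comment> \<open>This point shows that the box has nonempty interior, so that a zero integral
      forces \<open>f\<close> to vanish on all of it.\<close>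
    moreover have "(x0 + L / 2, (a + y1) / 2) \<in> box (x0, a) (x0 + L, y1 + 1)"
      using \<open>L > 0\<close> a by (auto simp: mem_box Basis_prod_def)
    ultimately have "\<forall>q\<in>B. f q = 0"
      unfolding \<kappa>_def B_def by (subst (asm) integral_cbox_eq_0_iff[OF cf]) (auto simp: f_def)
    then have "f p = 0" using \<open>L > 0\<close> a by (auto simp: B_def p cbox_Pair_eq)
    then show False using \<open>v p \<noteq> 0\<close> \<open>y1 > y0\<close> by (simp add: f_def p)
  qed
  ultimately have "\<kappa> > 0" by simp
  define C where "C = 4 * M\<^sup>2 * (Y - y0) * L"
  have "C \<ge> 0" using \<open>L > 0\<close> \<open>y1 > y0\<close> by (auto simp: C_def Y_def)
  \<comment> \<open>The first summand meets the hypothesis of the Carleman estimate, the second with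
    the extra 1 gives \<open>C < \<tau> * \<kappa>\<close>, and the 1 gives
    \<open>\<tau> \<ge> 1\<close>.\<close>
  define \<tau> where "\<tau> = 2 * K\<^sup>2 + C / \<kappa> + 1"
  have \<tau>: "\<tau> \<ge> 2 * K\<^sup>2" "\<tau> \<ge> 1" "\<tau> > C / \<kappa>"
    using \<open>C \<ge> 0\<close> \<open>\<kappa> > 0\<close> unfolding \<tau>_def by (auto simp: add_nonneg_pos)
  let ?g = "\<lambda>p. \<tau> / 2 * (exp (\<tau> * (snd p - Y)\<^sup>2) * ((v p)\<^sup>2 / (snd p - y0)\<^sup>2))"
  have cg: "?g integrable_on cbox (x0, a) (x0 + L, t)" for t
    using a by (intro integrable_continuous continuous_intros contv) (auto simp: cbox_Pair_eq)
  have "\<tau> / 2 * exp \<tau> * \<kappa> = integral B (\<lambda>p. \<tau> / 2 * exp \<tau> * f p)" by (simp add: \<kappa>_def)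
  also have "\<dots> \<le> integral B ?g"
    unfolding B_def
  proof (intro integral_le cg)
    show "(\<lambda>p. \<tau> / 2 * exp \<tau> * f p) integrable_on cbox (x0, a) (x0 + L, y1 + 1)"
      by (intro integrable_continuous continuous_intros cf)
    fix q assume "q \<in> cbox (x0, a) (x0 + L, y1 + 1)"
    then have "1\<^sup>2 \<le> (Y - snd q)\<^sup>2" by (intro power_mono) (auto simp: Y_def cbox_Pair_eq)
    then have "\<tau> * 1 \<le> \<tau> * (snd q - Y)\<^sup>2" using \<tau> by (intro mult_left_mono) (auto simp: power2_commute)
    then show "\<tau> / 2 * exp \<tau> * f q \<le> ?g q"
      unfolding f_def mult.assoc using \<tau> by (intro mult_left_mono mult_right_mono) auto
  qed
  also have "\<dots> \<le> integral (cbox (x0, a) (x0 + L, Y)) ?g"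
    unfolding B_def using \<tau> by (intro integral_subset_le cg) (auto simp: Y_def cbox_Pair_eq)
  also have "\<dots> \<le> 2 * \<tau> * M\<^sup>2 * (Y - y0) * L"
    using a \<tau> by (intro carleman_estimate[OF \<open>L > 0\<close> C2 per zero M]) (auto simp: Y_def intro!: K[unfolded Y_def])
  also have "\<dots> = \<tau> / 2 * C" by (simp add: C_def)
  finally have "exp \<tau> * \<kappa> \<le> C" using \<tau> by (simp add: mult.assoc)
  moreover have "C < exp \<tau> * \<kappa>"
  proof -
    have "C < \<tau> * \<kappa>" using \<tau>(3) \<open>\<kappa> > 0\<close> by (simp add: field_simps)
    also have "\<tau> \<le> exp \<tau>" using exp_ge_add_one_self[of \<tau>] by linarith
    then have "\<tau> * \<kappa> \<le> exp \<tau> * \<kappa>" using \<open>\<kappa> > 0\<close> by (intro mult_right_mono) auto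
    finally show ?thesis .
  qed
  ultimately show False by simp
qed

section \<open>The energy identity below the critical level\<close>

lemma DERIV_max0_square:
  "((\<lambda>t::real. (max 0 t)\<^sup>2) has_real_derivative 2 * max 0 t) (at t)"
proof (cases "t = 0")
  case True
  \<comment> \<open>At the kink the slope function in Caratheodory's criterion is
    \<open>max 0 z\<close> itself.\<close>
  have "isCont (\<lambda>z::real. max 0 z) 0" by (intro continuous_intros)
  then show ?thesis
    unfolding True CARAT_DERIV
    by (intro exI[of _ "\<lambda>z. max 0 z"]) (auto simp: power2_eq_square max_def)
next
  case False
  show ?thesis
  proof (cases "t > 0")
    case True
    have "((\<lambda>t::real. t\<^sup>2) has_real_derivative 2 * t) (at t)" by (auto intro!: derivative_eq_intros)
    then have "((\<lambda>t::real. (max 0 t)\<^sup>2) has_real_derivative 2 * t) (at t)"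
      by (rule has_field_derivative_transform_within_open[where S = "{0<..}"]) (use True in auto)
    then show ?thesis using True by simp
  next
    case neg: False
    have "((\<lambda>t::real. (max 0 t)\<^sup>2) has_real_derivative 0) (at t)"
      by (rule has_field_derivative_transform_within_open[where S = "{..<0}" and f = "\<lambda>_. 0"])
         (use neg False in auto)
    then show ?thesis using neg by simp
  qed
qed

text \<open>The square smooths the kink at \<open>- \<delta>\<close>. The split is made at 0, so
  that the kink lies inside the open set s < 0, where the denominator may be replaced by
  s^3.\<close>

lemma DERIV_cutoff_inverse:
  fixes \<delta> s :: real
  assumes "\<delta> > 0"
  defines "b \<equiv> min s (- \<delta>)"
  shows "((\<lambda>s. (- \<delta> - min s (- \<delta>))\<^sup>2 / (min s (- \<delta>)) ^ 3) has_real_derivative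
    - 2 * (- \<delta> - b) / b ^ 3 - 3 * (- \<delta> - b)\<^sup>2 / b ^ 4) (at s)"
proof (cases "s < 0")
  case True
  have "((\<lambda>s. (max 0 (- \<delta> - s))\<^sup>2 / s ^ 3) has_real_derivative
    - 2 * max 0 (- \<delta> - s) / s ^ 3 - 3 * (max 0 (- \<delta> - s))\<^sup>2 / s ^ 4) (at s)"
  proof -
    have "((\<lambda>s. (max 0 (- \<delta> - s))\<^sup>2) has_real_derivative 2 * max 0 (- \<delta> - s) * (- 1)) (at s)"
      by (rule DERIV_chain2[OF DERIV_max0_square]) (auto intro!: derivative_eq_intros)
    moreover have "((\<lambda>s. s ^ 3) has_real_derivative 3 * s\<^sup>2) (at s)"
      by (auto intro!: derivative_eq_intros)
    ultimately have "((\<lambda>s. (max 0 (- \<delta> - s))\<^sup>2 / s ^ 3) has_real_derivative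
        (2 * max 0 (- \<delta> - s) * (- 1) * s ^ 3 - (max 0 (- \<delta> - s))\<^sup>2 * (3 * s\<^sup>2)) / (s ^ 3 * s ^ 3)) (at s)"
      by (rule DERIV_divide) (use True in auto)
    then show ?thesis
      by (rule DERIV_cong) (use True in \<open>simp add: field_simps power2_eq_square power3_eq_cube power4_eq_xxxx\<close>)
  qed
  then have "((\<lambda>s. (- \<delta> - min s (- \<delta>))\<^sup>2 / (min s (- \<delta>)) ^ 3) has_real_derivative
    - 2 * max 0 (- \<delta> - s) / s ^ 3 - 3 * (max 0 (- \<delta> - s))\<^sup>2 / s ^ 4) (at s)"
    by (rule has_field_derivative_transform_within_open[where S = "{..<0}"]) (use True in \<open>auto simp: min_def max_def\<close>)
  then show ?thesis
    by (rule DERIV_cong) (cases "s < - \<delta>"; simp add: b_def)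
next
  case False
  have "((\<lambda>s. (- \<delta> - min s (- \<delta>))\<^sup>2 / (min s (- \<delta>)) ^ 3) has_real_derivative 0) (at s)"
    by (rule has_field_derivative_transform_within_open[where S = "{-\<delta><..}" and f = "\<lambda>_. 0"])
       (use False assms(1) in \<open>auto simp: min_def\<close>)
  then show ?thesis using False assms(1) by (simp add: b_def min_def)
qed

text \<open>With w = v / a, the pair (X, Y) is a^2 grad w and the test function is w (r / a)^2. The
  gradient of w yields the energy density; the gradient of the cutoff yields the last term, with its
  factor \<delta>.\<close>

lemma cutoff_energy_algebra:
  fixes a \<delta> v vx vy ux uy :: real
  assumes "\<delta> > 0"
  defines "b \<equiv> min a (- \<delta>)"
  defines "r \<equiv> - \<delta> - b" and "X \<equiv> a * vx - v * ux" and "Y \<equiv> a * vy - v * uy"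
  shows "(vx * (r\<^sup>2 / b ^ 3) + v * ((- 2 * r / b ^ 3 - 3 * r\<^sup>2 / b ^ 4) * ux)) * X
    + (vy * (r\<^sup>2 / b ^ 3) + v * ((- 2 * r / b ^ 3 - 3 * r\<^sup>2 / b ^ 4) * uy)) * Y
    = r\<^sup>2 * (X\<^sup>2 + Y\<^sup>2) / b ^ 4 + 2 * \<delta> * r * v * (X * ux + Y * uy) / b ^ 4"
proof (cases "a < - \<delta>")
  case True
  \<comment> \<open>In terms of the reciprocal of \<open>a\<close> and the relation
    \<open>i3\<close>, the claim becomes a polynomial identity.\<close>
  define i where "i = 1 / a"
  have b: "b = a" using True by (simp add: b_def)
  have "a \<noteq> 0" using True assms(1) by auto
  have vx: "vx = i * (X + v * ux)" and vy: "vy = i * (Y + v * uy)"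
    using \<open>a \<noteq> 0\<close> by (auto simp: i_def X_def Y_def)
  have i3: "i ^ 3 = a * i ^ 4"
    using \<open>a \<noteq> 0\<close> by (simp add: i_def power3_eq_cube power4_eq_xxxx)
  have "(vx * (r\<^sup>2 * i ^ 3) + v * ((- 2 * r * i ^ 3 - 3 * r\<^sup>2 * i ^ 4) * ux)) * X
    + (vy * (r\<^sup>2 * i ^ 3) + v * ((- 2 * r * i ^ 3 - 3 * r\<^sup>2 * i ^ 4) * uy)) * Y
    = r\<^sup>2 * i ^ 4 * (X\<^sup>2 + Y\<^sup>2) + v * (r\<^sup>2 * i ^ 4 - 2 * r * i ^ 3 - 3 * r\<^sup>2 * i ^ 4) * (X * ux + Y * uy)"
    unfolding vx vy by algebra
  also have "r\<^sup>2 * i ^ 4 - 2 * r * i ^ 3 - 3 * r\<^sup>2 * i ^ 4 = 2 * \<delta> * r * i ^ 4"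
    unfolding i3 r_def b by algebra
  finally show ?thesis by (simp add: b i_def power_divide power_one_over field_simps)
next
  case False
  then show ?thesis by (simp add: r_def b_def min_def)
qed

text \<open>
  The orientation is normalised to \<open>u\<^sub>y > 0\<close>; the other one is obtained by the reflection
  \<open>y \<mapsto> -y\<close>. The last assumption is what the absence of inflection points on \<open>{u = c}\<close> gives.
\<close>

locale traveling_profile =
  fixes L \<beta> c m M N :: real and u v :: "real \<times> real \<Rightarrow> real"
  assumes L_pos: "L > 0" and beta: "\<beta> \<ge> 0"
    and C2u: "C2_plane u" and C2v: "C2_plane v"
    and per_u: "x_periodic L u" and per_v: "x_periodic L v"
    and incompressible: "\<And>p. dx u p + dy v p = 0"
    and vorticity: "\<And>p. (u p - c) * laplacian v p + v p * (\<beta> - laplacian u p) = 0"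
    and m_pos: "m > 0" and dy_u: "\<And>p. m \<le> dy u p"
    and dx_v: "\<And>p. \<bar>dx v p\<bar> \<le> M" and dy_v: "\<And>p. \<bar>dy v p\<bar> \<le> M"
    and decay: "\<And>x. ((\<lambda>y. v (x, y)) \<longlongrightarrow> 0) at_bot"
    and N_nonneg: "N \<ge> 0" and dy_u_le: "\<forall>\<^sub>F y in at_bot. \<forall>x. \<bar>dy u (x, y)\<bar> \<le> N * \<bar>u (x, y) - c\<bar>"
    and critical: "\<And>p. u p = c \<Longrightarrow> v p = 0"
begin

section \<open>Monotonicity of \<open>u\<close> along vertical lines and the size of
  \<open>v\<close>\<close>

lemma C1: "C1_plane u" "C1_plane v" "C1_plane (dx u)" "C1_plane (dx v)" "C1_plane (dy u)" "C1_plane (dy v)"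
  using C2u C2v by (auto simp: C2_plane_def)

lemmas cont [THEN continuous_on_subset, OF subset_UNIV, continuous_intros] =
  C1_plane_continuous[OF C1(1)] C1_plane_continuous[OF C1(2)]
  C1_plane_continuous(2)[OF C1(3)] C1_plane_continuous(3)[OF C1(5)]
  C1_plane_continuous(2)[OF C1(4)] C1_plane_continuous(3)[OF C1(6)]

lemma M_nonneg: "M \<ge> 0" using dx_v[of undefined] by linarith

lemma u_increase: "y \<le> y' \<Longrightarrow> m * (y' - y) \<le> u (x, y') - u (x, y)"
proof (cases "y = y'")
  case False
  assume "y \<le> y'"
  then obtain z where "u (x, y') - u (x, y) = (y' - y) * dy u (x, z)"
    using MVT2[of y y' "\<lambda>s. u (x, s)" "\<lambda>s. dy u (x, s)"] False dy_has_derivative[OF C1(1)] by auto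
  then show ?thesis using mult_left_mono[OF dy_u[of "(x, z)"], of "y' - y"] \<open>y \<le> y'\<close>
    by (simp add: mult.commute)
qed simp

lemma critical_point_exists: "\<exists>y. u (x, y) = c"
proof -
  \<comment> \<open>With slope at least \<open>m\<close>, a change of height by \<open>K\<close>
    suffices to reach the level \<open>c\<close>.\<close>
  define K where "K = \<bar>u (x, 0) - c\<bar> / m"
  have "K \<ge> 0" "m * K = \<bar>u (x, 0) - c\<bar>" using m_pos by (auto simp: K_def)
  then have "u (x, - K) \<le> c" "c \<le> u (x, K)"
    using u_increase[of "- K" 0 x] u_increase[of 0 K x] by auto
  moreover have "continuous_on {- K..K} (\<lambda>y. u (x, y))"
    by (rule continuous_on_compose2[OF cont(1)]) (auto intro!: continuous_intros)
  ultimately show ?thesis using IVT'[of "\<lambda>y. u (x, y)" "- K" c K] \<open>K \<ge> 0\<close> by auto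
qed

text \<open>Each vertical line has a critical point, where \<open>v\<close> vanishes. Away from it
  |v| grows at rate at most \<open>M\<close> and |u - c| at rate at least \<open>m\<close>.\<close>

lemma v_le: "\<bar>v p\<bar> \<le> M / m * \<bar>u p - c\<bar>"
proof -
  obtain x y where p: "p = (x, y)" by (cases p)
  obtain y' where y': "u (x, y') = c" using critical_point_exists by blast
  have "m * \<bar>y - y'\<bar> \<le> \<bar>u (x, y) - u (x, y')\<bar>"
    using u_increase[of y y' x] u_increase[of y' y x] by (cases "y \<le> y'") auto
  then have "M / m * (m * \<bar>y - y'\<bar>) \<le> M / m * \<bar>u (x, y) - c\<bar>"
    unfolding y' using M_nonneg m_pos by (intro mult_left_mono) auto
  moreover have "\<bar>v (x, y) - v (x, y')\<bar> \<le> M * \<bar>y - y'\<bar>"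
    using dy_bounded_imp_lipschitz[OF C1(2) dy_v] .
  ultimately show ?thesis using critical[OF y'] m_pos by (simp add: p)
qed

text \<open>
  \<open>Q = a \<nabla>v - v \<nabla>u\<close> has divergence \<open>-\<beta> v\<close>. It is tested against \<open>v r\<^sup>2 / b\<^sup>3\<close>, a
  regularisation of \<open>v / a\<close> that is \<open>v (1 + \<delta> / a)\<^sup>2 / a\<close> for \<open>a < -\<delta>\<close> and vanishes for
  \<open>a \<ge> -\<delta>\<close>. With \<open>b\<close> in place of \<open>a\<close> no denominator vanishes.
\<close>

definition a where "a p = u p - c"
definition Q1 where "Q1 p = a p * dx v p - v p * dx u p"
definition Q2 where "Q2 p = a p * dy v p - v p * dy u p"
definition b where "b \<delta> p = min (a p) (- \<delta>)"
definition r where "r \<delta> p = - \<delta> - b \<delta> p"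
definition err where "err \<delta> p = 2 * \<delta> * r \<delta> p * v p * (Q1 p * dx u p + Q2 p * dy u p) / b \<delta> p ^ 4"
definition flux where "flux \<delta> p = v p * ((r \<delta> p)\<^sup>2 / b \<delta> p ^ 3) * Q2 p"

section \<open>The tested equation and its error terms\<close>

lemma b_neg: "\<delta> > 0 \<Longrightarrow> b \<delta> p < 0" by (auto simp: b_def min_def)

lemma cont_aux: "continuous_on A a" "continuous_on A Q1" "continuous_on A Q2" "continuous_on A (b \<delta>)" "continuous_on A (r \<delta>)"
proof -
  show a: "continuous_on A a" unfolding a_def by (intro continuous_intros)
  show b: "continuous_on A (b \<delta>)" unfolding b_def by (intro continuous_intros a)
  show "continuous_on A Q1" "continuous_on A Q2" "continuous_on A (r \<delta>)"
    unfolding Q1_def Q2_def r_def by (intro continuous_intros a b)+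
qed

lemma cont_err: "\<delta> > 0 \<Longrightarrow> continuous_on A (err \<delta>)"
  unfolding err_def using b_neg[of \<delta>] by (intro continuous_intros cont_aux) (simp add: less_imp_neq)

lemma cont_flux: "\<delta> > 0 \<Longrightarrow> continuous_on A (flux \<delta>)"
  unfolding flux_def using b_neg[of \<delta>] by (intro continuous_intros cont_aux) (simp add: less_imp_neq)

text \<open>The vertical sides cancel by periodicity, the cutoff \<open>r\<close> vanishes on the
  top side, and the term with \<beta> is dropped by its sign. There remain \<open>err\<close>, from
  the gradient of the cutoff, and the flux through the bottom.\<close>

lemma energy_inequality:
  assumes \<delta>: "\<delta> > 0" and "y1 \<le> y2" and top: "\<And>x. x \<in> {x0..x0 + L} \<Longrightarrow> u (x, y2) \<ge> c"
  shows "integral (cbox (x0, y1) (x0 + L, y2)) (\<lambda>p. (r \<delta> p)\<^sup>2 * ((Q1 p)\<^sup>2 + (Q2 p)\<^sup>2) / b \<delta> p ^ 4)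
    \<le> - integral (cbox (x0, y1) (x0 + L, y2)) (err \<delta>) - integral {x0..x0 + L} (\<lambda>x. flux \<delta> (x, y1))"
proof -
  let ?B = "cbox (x0, y1) (x0 + L, y2)"
  note Dx = dx_has_derivative[OF C1(1)] dx_has_derivative[OF C1(2)] dx_has_derivative[OF C1(3)] dx_has_derivative[OF C1(4)]
  note Dy = dy_has_derivative[OF C1(1)] dy_has_derivative[OF C1(2)] dy_has_derivative[OF C1(5)] dy_has_derivative[OF C1(6)]
  define g where "g p = (r \<delta> p)\<^sup>2 / b \<delta> p ^ 3" for p
  define g' where "g' p = - 2 * r \<delta> p / b \<delta> p ^ 3 - 3 * (r \<delta> p)\<^sup>2 / b \<delta> p ^ 4" for p
  define Fx where "Fx p = (dx v p * g p + v p * (g' p * dx u p)) * Q1 p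
      + v p * g p * (a p * dx (dx v) p - v p * dx (dx u) p)" for p
  define Gy where "Gy p = (dy v p * g p + v p * (g' p * dy u p)) * Q2 p
      + v p * g p * (a p * dy (dy v) p - v p * dy (dy u) p)" for p
  define S where "S p = (r \<delta> p)\<^sup>2 * ((Q1 p)\<^sup>2 + (Q2 p)\<^sup>2) / b \<delta> p ^ 4" for p
  have bn: "b \<delta> p \<noteq> 0" for p using b_neg[OF \<delta>, of p] by simp
  have cg: "continuous_on A g" "continuous_on A g'" for A
    unfolding g_def g'_def using bn by (auto intro!: continuous_intros cont_aux)
  have cF: "continuous_on A Fx" "continuous_on A Gy" for A
    unfolding Fx_def Gy_def by (auto intro!: continuous_intros cont_aux cg)
  have cS: "continuous_on A S" for A
    unfolding S_def using bn by (auto intro!: continuous_intros cont_aux)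
  have ga: "((\<lambda>s. (- \<delta> - min s (- \<delta>))\<^sup>2 / (min s (- \<delta>)) ^ 3) has_real_derivative g' p) (at (a p))" for p
    unfolding g'_def r_def b_def by (rule DERIV_cutoff_inverse[OF \<delta>])
  have ax: "((\<lambda>s. a (s, y)) has_real_derivative dx u (x, y)) (at x)"
    and ay: "((\<lambda>s. a (x, s)) has_real_derivative dy u (x, y)) (at y)" for x y
    unfolding a_def by (auto intro!: derivative_eq_intros Dx Dy)
  have gx: "((\<lambda>s. g (s, y)) has_real_derivative g' (x, y) * dx u (x, y)) (at x)" for x y
    using DERIV_chain2[OF ga[of "(x, y)"] ax] unfolding g_def r_def b_def .
  have gy: "((\<lambda>s. g (x, s)) has_real_derivative g' (x, y) * dy u (x, y)) (at y)" for x y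
    using DERIV_chain2[OF ga[of "(x, y)"] ay] unfolding g_def r_def b_def .
  have "integral ?B (\<lambda>p. Fx p + Gy p)
      = integral {x0..x0 + L} (\<lambda>x. flux \<delta> (x, y2) - flux \<delta> (x, y1))"
  proof (rule integral_divergence[OF _ _ _ _ cF])
    show "((\<lambda>s. v (s, y) * g (s, y) * Q1 (s, y)) has_real_derivative Fx (x, y)) (at x)" for x y
      unfolding Fx_def Q1_def by (auto intro!: derivative_eq_intros Dx ax gx simp: algebra_simps)
    have "((\<lambda>s. v (x, s) * g (x, s) * Q2 (x, s)) has_real_derivative Gy (x, y)) (at y)" for x y
      unfolding Gy_def Q2_def by (auto intro!: derivative_eq_intros Dy ay gy simp: algebra_simps)
    then show "((\<lambda>s. flux \<delta> (x, s)) has_real_derivative Gy (x, y)) (at y)" for x y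
      unfolding flux_def g_def .
    show "v (x0 + L, y) * g (x0 + L, y) * Q1 (x0 + L, y) = v (x0, y) * g (x0, y) * Q1 (x0, y)" for y
      using per_u per_v x_periodic_dx[OF per_u C1(1)] x_periodic_dx[OF per_v C1(2)]
      by (simp add: g_def r_def b_def a_def Q1_def x_periodic_def)
  qed (use L_pos \<open>y1 \<le> y2\<close> in auto)
  also have "\<dots> = integral {x0..x0 + L} (\<lambda>x. - flux \<delta> (x, y1))"
  proof (rule integral_cong)
    fix x assume "x \<in> {x0..x0 + L}"
    then have "r \<delta> (x, y2) = 0" using top[of x] \<delta> by (simp add: r_def b_def a_def min_def)
    then show "flux \<delta> (x, y2) - flux \<delta> (x, y1) = - flux \<delta> (x, y1)" by (simp add: flux_def)
  qed
  finally have div: "integral ?B (\<lambda>p. Fx p + Gy p) = - integral {x0..x0 + L} (\<lambda>x. flux \<delta> (x, y1))" by simp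
  have "S p + err \<delta> p \<le> Fx p + Gy p" for p
  proof -
    have "Fx p + Gy p = ((dx v p * g p + v p * (g' p * dx u p)) * Q1 p + (dy v p * g p + v p * (g' p * dy u p)) * Q2 p)
        + v p * g p * (a p * laplacian v p - v p * laplacian u p)"
      unfolding Fx_def Gy_def laplacian_def by (simp add: algebra_simps)
    also have "(dx v p * g p + v p * (g' p * dx u p)) * Q1 p + (dy v p * g p + v p * (g' p * dy u p)) * Q2 p
        = S p + err \<delta> p"
      using cutoff_energy_algebra[OF \<delta>, of "dx v p" "a p" "v p" "dx u p" "dy v p" "dy u p"]
      unfolding g_def g'_def S_def err_def Q1_def Q2_def r_def b_def by simp
    also have "a p * laplacian v p - v p * laplacian u p = - \<beta> * v p"
      using vorticity[of p] by (simp add: a_def algebra_simps)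
    finally have "Fx p + Gy p = S p + err \<delta> p + \<beta> * (v p)\<^sup>2 * (- g p)"
      by (simp add: power2_eq_square algebra_simps)
    \<comment> \<open>As \<open>b\<close> is negative, the weight \<open>g\<close> is nonpositive;
      with \<beta> \<ge> 0 the term to be dropped is nonnegative.\<close>
    moreover have "g p \<le> 0"
      unfolding g_def using b_neg[OF \<delta>, of p] by (intro divide_nonneg_nonpos) auto
    then have "\<beta> * (v p)\<^sup>2 * (- g p) \<ge> 0" using beta by (intro mult_nonneg_nonneg) auto
    ultimately show ?thesis by linarith
  qed
  then have "integral ?B (\<lambda>p. S p + err \<delta> p) \<le> integral ?B (\<lambda>p. Fx p + Gy p)"
    by (intro integral_le integrable_continuous continuous_intros cF cS cont_err[OF \<delta>])
  moreover have "integral ?B (\<lambda>p. S p + err \<delta> p) = integral ?B S + integral ?B (err \<delta>)"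
    by (intro integral_add integrable_continuous cS cont_err[OF \<delta>])
  ultimately have "integral ?B S \<le> - integral ?B (err \<delta>) - integral {x0..x0 + L} (\<lambda>x. flux \<delta> (x, y1))"
    using div by linarith
  then show ?thesis unfolding S_def .
qed

text \<open>Where a < -\<delta>, each of \<delta>, \<open>r\<close>, \<open>v\<close>,
  \<open>Q1\<close> and \<open>Q2\<close> is at most a multiple of |a|, which cancels the fourth
  power in the denominator. The resulting majorant is free of \<delta>.\<close>

lemma err_bound:
  assumes "\<delta> > 0"
  shows "\<bar>err \<delta> p\<bar> \<le> 2 * (M / m) * ((\<bar>dx v p\<bar> + M / m * \<bar>dx u p\<bar>) * \<bar>dx u p\<bar>
    + (\<bar>dy v p\<bar> + M / m * \<bar>dy u p\<bar>) * \<bar>dy u p\<bar>)" (is "_ \<le> 2 * (M / m) * ?W")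
proof (cases "a p < - \<delta>")
  case True
  define A where "A = \<bar>a p\<bar>"
  have A: "A > 0" "\<delta> \<le> A" "b \<delta> p ^ 4 = A ^ 4" using True \<open>\<delta> > 0\<close> by (auto simp: A_def b_def)
  have r: "0 \<le> r \<delta> p" "r \<delta> p \<le> A" using True \<open>\<delta> > 0\<close> by (auto simp: A_def r_def b_def)
  have v: "\<bar>v p\<bar> \<le> M / m * A" using v_le[of p] by (simp add: A_def a_def)
  have Mm: "M / m \<ge> 0" using M_nonneg m_pos by simp
  have Q: "\<bar>a p * s - v p * t\<bar> \<le> A * (\<bar>s\<bar> + M / m * \<bar>t\<bar>)" for s t
  proof -
    have "\<bar>a p * s - v p * t\<bar> \<le> A * \<bar>s\<bar> + \<bar>v p\<bar> * \<bar>t\<bar>"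
      unfolding A_def abs_mult[symmetric] by (rule abs_triangle_ineq4)
    also have "\<bar>v p\<bar> * \<bar>t\<bar> \<le> M / m * A * \<bar>t\<bar>" by (intro mult_right_mono v) auto
    finally show ?thesis by (simp add: algebra_simps)
  qed
  have "\<bar>Q1 p * dx u p + Q2 p * dy u p\<bar> \<le> \<bar>Q1 p\<bar> * \<bar>dx u p\<bar> + \<bar>Q2 p\<bar> * \<bar>dy u p\<bar>"
    unfolding abs_mult[symmetric] by (rule abs_triangle_ineq)
  also have "\<dots> \<le> A * (\<bar>dx v p\<bar> + M / m * \<bar>dx u p\<bar>) * \<bar>dx u p\<bar> + A * (\<bar>dy v p\<bar> + M / m * \<bar>dy u p\<bar>) * \<bar>dy u p\<bar>"
    unfolding Q1_def Q2_def by (intro add_mono mult_right_mono Q) auto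
  also have "\<dots> = A * ?W" by (simp add: algebra_simps)
  finally have QW: "\<bar>Q1 p * dx u p + Q2 p * dy u p\<bar> \<le> A * ?W" .
  have "\<bar>err \<delta> p\<bar> = 2 * \<delta> * r \<delta> p * \<bar>v p\<bar> * \<bar>Q1 p * dx u p + Q2 p * dy u p\<bar> / A ^ 4"
    unfolding err_def A(3) using r(1) A(1) \<open>\<delta> > 0\<close> by (simp add: abs_mult)
  also have "\<dots> \<le> 2 * A * A * (M / m * A) * (A * ?W) / A ^ 4"
  proof -
    have "0 \<le> 2 * A * A * (M / m * A)" using A(1) Mm by (intro mult_nonneg_nonneg) auto
    then show ?thesis
      using r A \<open>\<delta> > 0\<close> v QW by (intro divide_right_mono mult_mono) auto
  qed
  also have "\<dots> = 2 * (M / m) * ?W"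
    using A(1) by (simp add: power4_eq_xxxx)
  finally show ?thesis .
next
  case False
  then have "err \<delta> p = 0" by (simp add: err_def r_def b_def min_def)
  moreover have "0 \<le> 2 * (M / m) * ?W"
    using M_nonneg m_pos by (intro mult_nonneg_nonneg add_nonneg_nonneg) auto
  ultimately show ?thesis by simp
qed

text \<open>Below the critical level \<open>b\<close> tends to \<open>a\<close>, which is nonzero,
  and the factor \<delta> remains; elsewhere \<open>r\<close> is already 0.\<close>

lemma err_tendsto_0: "(\<lambda>n. err (inverse (real (Suc n))) p) \<longlonglongrightarrow> 0"
proof (cases "a p < 0")
  case True
  note lim = LIMSEQ_inverse_real_of_nat
  have b: "(\<lambda>n. b (inverse (real (Suc n))) p) \<longlonglongrightarrow> min (a p) (- 0)"
    unfolding b_def by (intro tendsto_intros lim)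
  have r: "(\<lambda>n. r (inverse (real (Suc n))) p) \<longlonglongrightarrow> - 0 - min (a p) (- 0)"
    unfolding r_def by (intro tendsto_intros lim b)
  have "(\<lambda>n. err (inverse (real (Suc n))) p) \<longlonglongrightarrow>
      2 * 0 * (- 0 - min (a p) (- 0)) * v p * (Q1 p * dx u p + Q2 p * dy u p) / min (a p) (- 0) ^ 4"
    unfolding err_def using True by (intro tendsto_intros lim b r) auto
  then show ?thesis by simp
next
  case False
  have "err (inverse (real (Suc n))) p = 0" for n
  proof -
    have "- inverse (real (Suc n)) < 0" by simp
    then have "b (inverse (real (Suc n))) p = - inverse (real (Suc n))"
      using False unfolding b_def by linarith
    then have "r (inverse (real (Suc n))) p = 0" by (simp add: r_def)
    then show ?thesis by (simp add: err_def)
  qed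
  then show ?thesis by simp
qed

text \<open>The growth condition on \<open>dy u\<close> makes all powers of |u - c| cancel and
  leaves a bound, uniform in \<delta>, that tends to 0 with \<open>v\<close>.\<close>

lemma flux_bound:
  assumes "\<delta> > 0" and N: "\<bar>dy u p\<bar> \<le> N * \<bar>u p - c\<bar>"
  shows "\<bar>flux \<delta> p\<bar> \<le> \<bar>v p\<bar> * (M + N * \<bar>v p\<bar>)"
proof (cases "a p < - \<delta>")
  case True
  define A where "A = \<bar>a p\<bar>"
  have A: "A > 0" "\<bar>b \<delta> p\<bar> = A" using True \<open>\<delta> > 0\<close> by (auto simp: A_def b_def)
  have r: "(r \<delta> p)\<^sup>2 \<le> A\<^sup>2" using True \<open>\<delta> > 0\<close> by (intro power_mono) (auto simp: A_def r_def b_def)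
  have "\<bar>Q2 p\<bar> \<le> A * \<bar>dy v p\<bar> + \<bar>v p\<bar> * \<bar>dy u p\<bar>"
    unfolding A_def abs_mult[symmetric] Q2_def by (rule abs_triangle_ineq4)
  also have "\<dots> \<le> A * M + \<bar>v p\<bar> * (N * A)"
    using dy_v[of p] N A(1) by (intro add_mono mult_left_mono) (auto simp: A_def a_def)
  also have "\<dots> = A * (M + N * \<bar>v p\<bar>)" by (simp add: algebra_simps)
  finally have Q: "\<bar>Q2 p\<bar> \<le> A * (M + N * \<bar>v p\<bar>)" .
  have "\<bar>flux \<delta> p\<bar> = \<bar>v p\<bar> * ((r \<delta> p)\<^sup>2 / A ^ 3) * \<bar>Q2 p\<bar>"
    unfolding flux_def by (simp add: abs_mult power_abs A(2))
  also have "\<dots> \<le> \<bar>v p\<bar> * (A\<^sup>2 / A ^ 3) * (A * (M + N * \<bar>v p\<bar>))"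
    using A(1) r Q by (intro mult_mono divide_right_mono) auto
  also have "\<dots> = \<bar>v p\<bar> * (M + N * \<bar>v p\<bar>)"
    using A(1) by (simp add: power2_eq_square power3_eq_cube)
  finally show ?thesis .
next
  case False
  then have "flux \<delta> p = 0" by (simp add: flux_def r_def b_def min_def)
  then show ?thesis using M_nonneg N_nonneg by simp
qed

text \<open>\<open>Q2\<close> is a^2 times the y-derivative of v / a. A nonzero value at one point
  would keep the energy above a positive constant, against vanishing error and boundary
  terms.\<close>

lemma gradient_parallel:
  assumes "u p < c"
  shows "Q2 p = 0"
proof (rule ccontr)
  assume "Q2 p \<noteq> 0"
  obtain xp yp where p: "p = (xp, yp)" by (cases p)
  \<comment> \<open>The period cell is centred at \<open>p\<close>; \<eta> and
    \<open>\<kappa>0\<close> are half of -a and of (Q2 / a)^2 at \<open>p\<close>, so that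
    \<open>p\<close> satisfies the strict inequalities defining \<open>U\<close>.\<close>
  define x0 where "x0 = xp - L / 2"
  define \<eta> where "\<eta> = - a p / 2"
  define \<kappa>0 where "\<kappa>0 = (Q2 p)\<^sup>2 / (2 * (a p)\<^sup>2)"
  have ap: "a p < 0" using assms by (simp add: a_def)
  have "\<eta> > 0" "\<kappa>0 > 0" using ap \<open>Q2 p \<noteq> 0\<close> by (auto simp: \<eta>_def \<kappa>0_def)
  \<comment> \<open>On a box inside \<open>U\<close> the energy density is at least \<open>\<kappa>0 / 4\<close>, uniformly in \<open>\<delta>\<close>; letting
      first \<open>\<delta> \<rightarrow> 0\<close> and then the bottom of the domain tend to \<open>-\<infinity>\<close> gives a contradiction.\<close>
  define U where "U = {q. a q < - \<eta>} \<inter> {q. \<kappa>0 * (a q)\<^sup>2 < (Q2 q)\<^sup>2}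
    \<inter> {q. x0 < fst q} \<inter> {q. fst q < x0 + L} \<inter> {q. yp - 1 < snd q} \<inter> {q. snd q < yp + 1}"
  have "open U" unfolding U_def
    by (intro open_Int open_Collect_less continuous_intros cont_aux)
  moreover have "p \<in> U"
    using ap \<open>Q2 p \<noteq> 0\<close> L_pos by (auto simp: U_def \<eta>_def \<kappa>0_def p x0_def)
  ultimately obtain k1 k2 where k: "cbox k1 k2 \<subseteq> U" "\<forall>i\<in>Basis. k1 \<bullet> i < k2 \<bullet> i"
    by (rule open_contains_cbox)
  define \<kappa> where "\<kappa> = measure lborel (cbox k1 k2) * (\<kappa>0 / 4)"
  have "\<kappa> > 0" using content_pos_lt[OF k(2)] \<open>\<kappa>0 > 0\<close> by (simp add: \<kappa>_def)
  have "compact ((\<lambda>x. u (x, 0)) ` {x0..x0 + L})"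
    by (intro compact_continuous_image continuous_on_slice cont compact_Icc)
  then have "bdd_below ((\<lambda>x. u (x, 0)) ` {x0..x0 + L})"
    by (intro bounded_imp_bdd_below compact_imp_bounded)
  then obtain l where l: "\<And>x. x \<in> {x0..x0 + L} \<Longrightarrow> l \<le> u (x, 0)" unfolding bdd_below_def by blast
  \<comment> \<open>Rising with slope at least \<open>m\<close> from at least \<open>l\<close> at
    height 0, \<open>u\<close> has reached \<open>c\<close> at height \<open>T\<close>; the other
    summands put \<open>U\<close> below \<open>T\<close>.\<close>
  define T where "T = \<bar>c - l\<bar> / m + \<bar>yp\<bar> + 1"
  have "\<bar>c - l\<bar> / m \<ge> 0" using m_pos by simp
  have T: "T \<ge> 0" "T \<ge> yp + 1" unfolding T_def using \<open>\<bar>c - l\<bar> / m \<ge> 0\<close> by linarith+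
  have top: "u (x, T) \<ge> c" if "x \<in> {x0..x0 + L}" for x
  proof -
    have "m * (\<bar>c - l\<bar> / m) \<le> m * T" using m_pos by (intro mult_left_mono) (auto simp: T_def)
    then have "\<bar>c - l\<bar> \<le> m * T" using m_pos by simp
    then show ?thesis using u_increase[of 0 T x] T l[OF that] by simp
  qed
  have lower: "\<kappa> \<le> integral (cbox (x0, y) (x0 + L, T)) (\<lambda>q. (r \<delta> q)\<^sup>2 * ((Q1 q)\<^sup>2 + (Q2 q)\<^sup>2) / b \<delta> q ^ 4)"
    if \<delta>: "\<delta> > 0" "2 * \<delta> \<le> \<eta>" and y: "y \<le> yp - 1" for \<delta> y
  proof -
    let ?S = "\<lambda>q. (r \<delta> q)\<^sup>2 * ((Q1 q)\<^sup>2 + (Q2 q)\<^sup>2) / b \<delta> q ^ 4"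
    have cS: "?S integrable_on cbox w z" for w z
      using b_neg[OF \<delta>(1)] by (intro integrable_continuous continuous_intros cont_aux) (simp add: less_imp_neq)
    have "\<kappa> = integral (cbox k1 k2) (\<lambda>_. \<kappa>0 / 4)" by (simp add: \<kappa>_def)
    also have "\<dots> \<le> integral (cbox k1 k2) ?S"
    proof (rule integral_le[OF _ cS])
      fix q assume "q \<in> cbox k1 k2"
      then have q: "a q < - \<eta>" "\<kappa>0 * (a q)\<^sup>2 \<le> (Q2 q)\<^sup>2" using k(1) by (auto simp: U_def)
      have b: "b \<delta> q = a q" using q \<delta> by (simp add: b_def)
      have "a q < 0" using q \<open>\<eta> > 0\<close> by simp
      \<comment> \<open>Since 2 \<delta> \<le> \<eta> < -a, the cutoff retains r \<ge> -a / 2,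
        whence the factor 1/4.\<close>
      have "(- a q / 2)\<^sup>2 \<le> (r \<delta> q)\<^sup>2" using q \<delta> by (intro power_mono) (auto simp: r_def b)
      then have "(a q)\<^sup>2 / 4 * (\<kappa>0 * (a q)\<^sup>2) \<le> (r \<delta> q)\<^sup>2 * ((Q1 q)\<^sup>2 + (Q2 q)\<^sup>2)"
        using q(2) \<open>\<kappa>0 > 0\<close> by (intro mult_mono) (auto simp: power_divide intro: add_increasing)
      then have "(a q)\<^sup>2 / 4 * (\<kappa>0 * (a q)\<^sup>2) / a q ^ 4 \<le> ?S q"
        unfolding b by (intro divide_right_mono) auto
      also have "(a q)\<^sup>2 / 4 * (\<kappa>0 * (a q)\<^sup>2) / a q ^ 4 = \<kappa>0 / 4"
        using \<open>a q < 0\<close> by (simp add: power2_eq_square power4_eq_xxxx)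
      finally show "\<kappa>0 / 4 \<le> ?S q" .
    qed auto
    also have "\<dots> \<le> integral (cbox (x0, y) (x0 + L, T)) ?S"
    proof (rule integral_subset_le[OF _ cS cS])
      show "cbox k1 k2 \<subseteq> cbox (x0, y) (x0 + L, T)"
        using k(1) T y by (force simp: U_def cbox_Pair_eq)
    qed (simp add: zero_le_even_power)
    finally show ?thesis .
  qed
  define h where "h x y = \<bar>v (x, y)\<bar> * (M + N * \<bar>v (x, y)\<bar>)" for x y
  have ch: "(\<lambda>x. h x y) integrable_on {x0..x0 + L}" for y unfolding h_def
    using continuous_on_slice(1)[OF C1_plane_continuous(1)[OF C1(2)]]
    by (intro integrable_continuous_interval continuous_intros)
  \<comment> \<open>The bottom is fixed while \<delta> tends to 0: the error vanishes by dominated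
    convergence, and \<open>h\<close> bounds the flux for every \<delta>.\<close>
  have bottom: "\<kappa> \<le> integral {x0..x0 + L} (\<lambda>x. h x y)"
    if y: "y \<le> yp - 1" and N: "\<And>x. \<bar>dy u (x, y)\<bar> \<le> N * \<bar>u (x, y) - c\<bar>" for y
  proof -
    let ?B = "cbox (x0, y) (x0 + L, T)"
    let ?\<delta> = "\<lambda>n. inverse (real (Suc n))"
    let ?W = "\<lambda>p. 2 * (M / m) * ((\<bar>dx v p\<bar> + M / m * \<bar>dx u p\<bar>) * \<bar>dx u p\<bar>
      + (\<bar>dy v p\<bar> + M / m * \<bar>dy u p\<bar>) * \<bar>dy u p\<bar>)"
    have "(\<lambda>n. integral ?B (err (?\<delta> n))) \<longlonglongrightarrow> integral ?B (\<lambda>_. 0)"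
    proof (rule dominated_convergence(2))
      show "err (?\<delta> n) integrable_on ?B" for n by (intro integrable_continuous cont_err) simp
      show "?W integrable_on ?B" by (intro integrable_continuous continuous_intros)
      show "norm (err (?\<delta> n) p) \<le> ?W p" for n p unfolding real_norm_def by (rule err_bound) simp
    qed (rule err_tendsto_0)
    then have "(\<lambda>n. - integral ?B (err (?\<delta> n)) + integral {x0..x0 + L} (\<lambda>x. h x y))
        \<longlonglongrightarrow> - 0 + integral {x0..x0 + L} (\<lambda>x. h x y)"
      by (intro tendsto_intros) simp
    moreover have "\<forall>\<^sub>F n in sequentially. \<kappa> \<le> - integral ?B (err (?\<delta> n)) + integral {x0..x0 + L} (\<lambda>x. h x y)"
    proof -
      have "\<forall>\<^sub>F n in sequentially. ?\<delta> n < \<eta> / 2"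
        using order_tendstoD(2)[OF LIMSEQ_inverse_real_of_nat, of "\<eta> / 2"] \<open>\<eta> > 0\<close> by simp
      then show ?thesis
      proof eventually_elim
        case (elim n)
        have "y \<le> T" using y T by simp
        have d0: "?\<delta> n > 0" by simp
        have "\<kappa> \<le> - integral ?B (err (?\<delta> n)) - integral {x0..x0 + L} (\<lambda>x. flux (?\<delta> n) (x, y))"
          using order_trans[OF lower[OF d0 _ y] energy_inequality[OF d0 \<open>y \<le> T\<close> top]] elim by simp
        moreover have "- integral {x0..x0 + L} (\<lambda>x. flux (?\<delta> n) (x, y)) = integral {x0..x0 + L} (\<lambda>x. - flux (?\<delta> n) (x, y))"
          by simp
        moreover have "\<dots> \<le> integral {x0..x0 + L} (\<lambda>x. h x y)"
        proof (rule integral_le[OF _ ch])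
          show "(\<lambda>x. - flux (?\<delta> n) (x, y)) integrable_on {x0..x0 + L}"
            by (intro integrable_continuous_interval continuous_on_minus continuous_on_slice cont_flux d0)
          show "- flux (?\<delta> n) (x, y) \<le> h x y" for x
            using flux_bound[OF d0 N, of x] unfolding h_def by linarith
        qed
        ultimately show ?case by linarith
      qed
    qed
    ultimately show ?thesis by (intro tendsto_lowerbound[where F = sequentially]) auto
  qed
  \<comment> \<open>Decay is known on each vertical line separately. One line and the bound on
    \<open>dx v\<close> give a bound across the whole cell, which yields the majorant as the bottom
    descends.\<close>
  have "\<forall>\<^sub>F y in at_bot. \<bar>v (x0, y)\<bar> < 1"
    using order_tendstoD(2)[OF tendsto_rabs[OF decay[of x0]], of 1] by simp
  then have "\<forall>\<^sub>F y in at_bot. \<bar>v (x0, y)\<bar> < 1 \<and> (\<forall>x. \<bar>dy u (x, y)\<bar> \<le> N * \<bar>u (x, y) - c\<bar>) \<and> y \<le> yp - 1"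
    using dy_u_le eventually_le_at_bot[of "yp - 1"] by eventually_elim auto
  then obtain Z where Z: "\<And>y. y \<le> Z \<Longrightarrow> \<bar>v (x0, y)\<bar> < 1"
      "\<And>x y. y \<le> Z \<Longrightarrow> \<bar>dy u (x, y)\<bar> \<le> N * \<bar>u (x, y) - c\<bar>" "\<And>y. y \<le> Z \<Longrightarrow> y \<le> yp - 1"
    unfolding eventually_at_bot_linorder by blast
  have "(\<lambda>n. integral {x0..x0 + L} (\<lambda>x. h x (Z - real n))) \<longlonglongrightarrow> integral {x0..x0 + L} (\<lambda>_. 0)"
  proof (rule dominated_convergence(2))
    show "(\<lambda>x. (1 + M * L) * (M + N * (1 + M * L))) integrable_on {x0..x0 + L}" by (intro integrable_const_ivl)
    show "norm (h x (Z - real n)) \<le> (1 + M * L) * (M + N * (1 + M * L))" if "x \<in> {x0..x0 + L}" for n x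
    proof -
      have "\<bar>v (x, Z - real n) - v (x0, Z - real n)\<bar> \<le> M * \<bar>x - x0\<bar>"
        by (rule dx_bounded_imp_lipschitz[OF C1(2) dx_v])
      also have "\<dots> \<le> M * L" using that M_nonneg by (intro mult_left_mono) auto
      finally have "\<bar>v (x, Z - real n)\<bar> \<le> 1 + M * L" using Z(1)[of "Z - real n"] by linarith
      then show ?thesis unfolding h_def real_norm_def abs_mult using M_nonneg N_nonneg L_pos
        by (auto intro!: mult_mono add_mono mult_left_mono)
    qed
    show "(\<lambda>n. h x (Z - real n)) \<longlonglongrightarrow> 0" for x
    proof -
      have "filterlim (\<lambda>n. Z - real n) at_bot sequentially"
        by (intro filterlim_uminus_at_bot[THEN iffD2]) (simp, real_asymp)
      then have "(\<lambda>n. v (x, Z - real n)) \<longlonglongrightarrow> 0" by (rule filterlim_compose[OF decay])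
      then have "(\<lambda>n. h x (Z - real n)) \<longlonglongrightarrow> \<bar>0\<bar> * (M + N * \<bar>0\<bar>)"
        unfolding h_def by (intro tendsto_intros)
      then show ?thesis by simp
    qed
  qed (rule ch)
  moreover have "\<kappa> \<le> integral {x0..x0 + L} (\<lambda>x. h x (Z - real n))" for n
    using Z(2)[of "Z - real n"] Z(3)[of "Z - real n"] by (intro bottom) auto
  ultimately have "\<kappa> \<le> integral {x0..x0 + L} (\<lambda>_. 0)"
    by (intro LIMSEQ_le_const) auto
  then show False using \<open>\<kappa> > 0\<close> by simp
qed

section \<open>Vanishing of \<open>v\<close> below a horizontal critical level\<close>

lemma v_zero_below:
  assumes "u (x, y) < c"
  shows "v (x, y) = 0"
proof -
  have neg: "a (x, s) < 0" "a (x, s) \<le> a (x, y)" if "s \<le> y" for s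
  proof -
    have "0 \<le> m * (y - s)" using m_pos that by simp
    then show "a (x, s) < 0" "a (x, s) \<le> a (x, y)"
      using u_increase[OF that, of x] assms unfolding a_def by linarith+
  qed
  have "\<exists>k. \<forall>s\<in>{..y}. v (x, s) / a (x, s) = k"
  proof (rule has_field_derivative_zero_constant)
    fix s assume s: "s \<in> {..y}"
    have a0: "a (x, s) \<noteq> 0" using neg(1)[of s] s by simp
    have "((\<lambda>s. a (x, s)) has_real_derivative dy u (x, s)) (at s)"
      unfolding a_def by (auto intro!: derivative_eq_intros dy_has_derivative[OF C1(1)])
    then have "((\<lambda>s. v (x, s) / a (x, s)) has_real_derivative
        (dy v (x, s) * a (x, s) - v (x, s) * dy u (x, s)) / (a (x, s) * a (x, s))) (at s)"
      using a0 by (intro DERIV_divide dy_has_derivative[OF C1(2)])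
    moreover have "dy v (x, s) * a (x, s) - v (x, s) * dy u (x, s) = 0"
      using gradient_parallel[of "(x, s)"] neg(1)[of s] s by (simp add: Q2_def a_def mult.commute)
    ultimately show "((\<lambda>s. v (x, s) / a (x, s)) has_real_derivative 0) (at s within {..y})"
      by (simp add: has_field_derivative_at_within)
  qed simp
  then obtain k where k': "\<And>s. s \<le> y \<Longrightarrow> v (x, s) / a (x, s) = k" by auto
  have k: "v (x, s) = k * a (x, s)" if "s \<le> y" for s
    using k'[OF that] neg(1)[OF that] by (simp add: field_simps)
  \<comment> \<open>On this half-line \<open>v\<close> is a fixed multiple of \<open>a\<close>, and
    |a| does not decrease downwards, so decay of \<open>v\<close> leaves only the value 0.\<close>
  have "\<bar>v (x, y)\<bar> \<le> \<bar>v (x, s)\<bar>" if "s \<le> y" for s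
    unfolding k[OF that] k[OF order_refl] abs_mult using neg[OF that] neg[of y] by (intro mult_left_mono) auto
  then have "\<forall>\<^sub>F s in at_bot. \<bar>v (x, y)\<bar> \<le> \<bar>v (x, s)\<bar>"
    using eventually_le_at_bot[of y] by (rule eventually_mono[rotated])
  then have "\<bar>v (x, y)\<bar> \<le> \<bar>0\<bar>"
    by (intro tendsto_lowerbound[OF tendsto_rabs[OF decay[of x]]]) auto
  then show ?thesis by simp
qed

text \<open>
  Where \<open>u < c\<close>, \<open>v = 0\<close> and incompressibility give \<open>u\<^sub>x = 0\<close>, so that the \<open>C\<^sup>1\<close> function
  \<open>max 0 (c - u)\<^sup>2\<close> does not depend on \<open>x\<close>.
\<close>

lemma below_independent_of_x:
  assumes "u (x, y) < c"
  shows "u (x', y) < c"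
proof -
  have "((\<lambda>s. (max 0 (c - u (s, y)))\<^sup>2) has_real_derivative 0) (at s)" for s
  proof -
    have "((\<lambda>s. (max 0 (c - u (s, y)))\<^sup>2) has_real_derivative 2 * max 0 (c - u (s, y)) * (- dx u (s, y))) (at s)"
      by (rule DERIV_chain2[OF DERIV_max0_square]) (auto intro!: derivative_eq_intros dx_has_derivative[OF C1(1)])
    moreover have "max 0 (c - u (s, y)) * dx u (s, y) = 0"
    proof (cases "u (s, y) < c")
      case True
      have op: "open {t. u (s, t) < c}"
        by (intro open_Collect_less continuous_on_slice cont continuous_on_const)
      have "((\<lambda>t. v (s, t)) has_real_derivative 0) (at y)"
        by (rule has_field_derivative_transform_within_open[OF _ op, of "\<lambda>_. 0"])
           (use True in \<open>auto simp: v_zero_below\<close>)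
      then have "dy v (s, y) = 0" by (rule dy_eqI)
      then show ?thesis using incompressible[of "(s, y)"] by simp
    qed simp
    then have "2 * max 0 (c - u (s, y)) * (- dx u (s, y)) = 0" by simp
    ultimately show ?thesis by (simp only:)
  qed
  then have "(max 0 (c - u (x, y)))\<^sup>2 = (max 0 (c - u (x', y)))\<^sup>2"
    by (rule DERIV_isconst_all[rule_format, of "\<lambda>s. (max 0 (c - u (s, y)))\<^sup>2"])
  then show ?thesis using assms by (auto simp: max_def split: if_splits)
qed

text \<open>If the critical heights of two vertical lines differed, the lower of them would lie
  below the critical level on one line and exactly on it on the other.\<close>

lemma critical_level_horizontal:
  obtains y0 where "\<And>x. u (x, y0) = c"
proof -
  obtain y0 where y0: "u (0, y0) = c" using critical_point_exists by blast
  have strict: "u (x, y) < u (x, y')" if "y < y'" for x y y'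
  proof -
    have "0 < m * (y' - y)" using m_pos that by simp
    then show ?thesis using u_increase[of y y' x] that by linarith
  qed
  have "u (x, y0) = c" for x
  proof -
    obtain y where y: "u (x, y) = c" using critical_point_exists by blast
    have "\<not> y < y0" using strict[of y y0 0] below_independent_of_x[of 0 y x] y y0 by auto
    moreover have "\<not> y0 < y" using strict[of y0 y x] below_independent_of_x[of x y0 0] y y0 by auto
    ultimately show ?thesis using y by (simp add: antisym_conv3)
  qed
  then show thesis by (rule that)
qed

section \<open>Continuation above the critical level\<close>

theorem v_zero: "v p = 0"
proof -
  obtain y0 where y0: "\<And>x. u (x, y0) = c" by (rule critical_level_horizontal) blast
  have below: "v (x, y) = 0" if "y \<le> y0" for x y
  proof (cases "y = y0")
    case True
    then show ?thesis using critical[of "(x, y)"] y0[of x] by simp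
  next
    case False
    then have "0 < m * (y0 - y)" using m_pos that by simp
    then show ?thesis using u_increase[OF that, of x] y0[of x] by (intro v_zero_below) simp
  qed
  \<comment> \<open>The vorticity equation relates |laplacian v| |u - c| to |v| |\<beta> - laplacian
    u|. The last factor is bounded on the closed cell, and u - c \<ge> m (y - y0).\<close>
  have K: "\<exists>K. \<forall>x\<in>{x0..x0 + L}. \<forall>y\<in>{y0<..Y}. \<bar>laplacian v (x, y)\<bar> * (y - y0) \<le> K * \<bar>v (x, y)\<bar>" for x0 Y
  proof -
    let ?B = "cbox (x0, y0) (x0 + L, Y)"
    have "compact ((\<lambda>p. \<bar>\<beta> - laplacian u p\<bar>) ` ?B)"
      unfolding laplacian_def by (intro compact_continuous_image continuous_intros compact_cbox)
    then have "bdd_above ((\<lambda>p. \<bar>\<beta> - laplacian u p\<bar>) ` ?B)"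
      by (intro bounded_imp_bdd_above compact_imp_bounded)
    then obtain K where K: "\<And>p. p \<in> ?B \<Longrightarrow> \<bar>\<beta> - laplacian u p\<bar> \<le> K"
      unfolding bdd_above_def by blast
    have "\<bar>laplacian v (x, y)\<bar> * (y - y0) \<le> K / m * \<bar>v (x, y)\<bar>"
      if x: "x \<in> {x0..x0 + L}" and y: "y \<in> {y0<..Y}" for x y
    proof -
      have "m * (y - y0) \<le> \<bar>u (x, y) - c\<bar>" using u_increase[of y0 y x] y y0[of x] by simp
      then have "\<bar>laplacian v (x, y)\<bar> * (m * (y - y0)) \<le> \<bar>laplacian v (x, y)\<bar> * \<bar>u (x, y) - c\<bar>"
        by (rule mult_left_mono) simp
      also have "\<dots> = \<bar>v (x, y)\<bar> * \<bar>\<beta> - laplacian u (x, y)\<bar>"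
        using vorticity[of "(x, y)"] unfolding abs_mult[symmetric] by (simp add: add_eq_0_iff mult.commute)
      also have "\<dots> \<le> \<bar>v (x, y)\<bar> * K"
        using x y by (intro mult_left_mono K) (auto simp: cbox_Pair_eq)
      finally show ?thesis using m_pos by (simp add: field_simps)
    qed
    then show ?thesis by blast
  qed
  show ?thesis
    by (rule carleman_unique_continuation[OF L_pos C2v per_v below dx_v dy_v K])
qed

end

section \<open>Reflection and conclusion\<close>

text \<open>The factor \<sigma> is a sign. Differentiation in y reverses it, so that
  \<open>u\<close> taken with 1 and \<open>v\<close> with -1 stay divergence free.\<close>

definition reflect :: "real \<Rightarrow> (real \<times> real \<Rightarrow> real) \<Rightarrow> real \<times> real \<Rightarrow> real" where
  "reflect \<sigma> f p = \<sigma> * f (fst p, - snd p)"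

lemma reflect_has_derivative:
  assumes "C1_plane f"
  shows "((\<lambda>s. reflect \<sigma> f (s, y)) has_real_derivative reflect \<sigma> (dx f) (x, y)) (at x)"
    and "((\<lambda>s. reflect \<sigma> f (x, s)) has_real_derivative reflect (- \<sigma>) (dy f) (x, y)) (at y)"
proof -
  show "((\<lambda>s. reflect \<sigma> f (s, y)) has_real_derivative reflect \<sigma> (dx f) (x, y)) (at x)"
    unfolding reflect_def using assms by (auto intro!: derivative_eq_intros dx_has_derivative)
  have "((\<lambda>s. f (x, - s)) has_real_derivative dy f (x, - y) * (- 1)) (at y)"
    by (rule DERIV_chain2[where f = "\<lambda>s. f (x, s)", OF dy_has_derivative[OF assms]])
       (auto intro!: derivative_eq_intros)
  from DERIV_cmult[OF this, of \<sigma>]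
  show "((\<lambda>s. reflect \<sigma> f (x, s)) has_real_derivative reflect (- \<sigma>) (dy f) (x, y)) (at y)"
    unfolding reflect_def by simp
qed

lemma
  assumes "C1_plane f"
  shows dx_reflect: "dx (reflect \<sigma> f) = reflect \<sigma> (dx f)"
    and dy_reflect: "dy (reflect \<sigma> f) = reflect (- \<sigma>) (dy f)"
  using reflect_has_derivative[OF assms] by (auto intro!: ext dx_eqI dy_eqI)

lemma continuous_on_reflect: "continuous_on UNIV f \<Longrightarrow> continuous_on UNIV (reflect \<sigma> f)"
  unfolding reflect_def by (auto intro!: continuous_intros continuous_on_compose2[of UNIV f])

lemma C1_plane_reflect:
  assumes f: "C1_plane f"
  shows "C1_plane (reflect \<sigma> f)"
proof -
  have "(\<lambda>s. reflect \<sigma> f (s, y)) differentiable at x" "(\<lambda>s. reflect \<sigma> f (x, s)) differentiable at y" for x y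
    unfolding real_differentiable_def using reflect_has_derivative[OF f] by blast+
  then show ?thesis
    unfolding C1_plane_def dx_reflect[OF f] dy_reflect[OF f]
    by (simp add: continuous_on_reflect C1_plane_continuous[OF f])
qed

lemma
  assumes f: "C2_plane f"
  shows C2_plane_reflect: "C2_plane (reflect \<sigma> f)"
    and laplacian_reflect: "laplacian (reflect \<sigma> f) = reflect \<sigma> (laplacian f)"
proof -
  have C1: "C1_plane f" "C1_plane (dx f)" "C1_plane (dy f)" using f by (auto simp: C2_plane_def)
  show "C2_plane (reflect \<sigma> f)"
    unfolding C2_plane_def dx_reflect[OF C1(1)] dy_reflect[OF C1(1)] by (simp add: C1 C1_plane_reflect)
  show "laplacian (reflect \<sigma> f) = reflect \<sigma> (laplacian f)"
    unfolding laplacian_def[abs_def] dx_reflect[OF C1(1)] dy_reflect[OF C1(1)] dx_reflect[OF C1(2)] dy_reflect[OF C1(3)]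
    by (auto simp: reflect_def algebra_simps)
qed

lemma continuous_nonzero_sign:
  fixes f :: "real \<Rightarrow> real"
  assumes "continuous_on UNIV f" and C: "C > 0" "\<And>y. \<bar>f y\<bar> \<ge> C"
  shows "(\<forall>y. f y \<ge> C) \<or> (\<forall>y. f y \<le> - C)"
proof (rule ccontr)
  assume "\<not> ?thesis"
  then obtain y z where "f y < C" "f z > - C" by (auto simp: not_le)
  then have "f y \<le> 0" "0 \<le> f z" using C(2)[of y] C(2)[of z] C(1) by auto
  moreover have "connected (range f)"
    using assms(1) by (intro connected_continuous_image) auto
  ultimately have "0 \<in> range f" by (meson connectedD_interval rangeI)
  then show False using C by (metis abs_zero not_less rangeE)
qed

section \<open>Reduction to the normalised profile\<close>

theorem theorem5p1:
  fixes L \<beta> c C0 C1 \<epsilon>0 :: real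
    and u0 :: "real \<Rightarrow> real"
    and u v :: "real \<times> real \<Rightarrow> real"
  assumes "L > 0" and "\<beta> \<ge> 0"
    and "C2_line u0"
    and "C0 > 0" and "C1 > 0"
    and "\<forall>y. \<bar>deriv u0 y\<bar> \<ge> C0"
    and "\<exists>R. \<forall>y. \<bar>y\<bar> \<ge> R \<longrightarrow> u0 y \<noteq> 0 \<and> \<bar>deriv u0 y / u0 y\<bar> \<le> C1"
    and "0 < \<epsilon>0" and "\<epsilon>0 < C0"
    and "x_periodic L u" and "x_periodic L v"
    and "C2_plane u" and "C2_plane v"
    and "traveling_wave_solution L \<beta> c u v"
    and "\<not> shear_flow u v"
    and "\<forall>x. ((\<lambda>y. v (x, y)) \<longlongrightarrow> 0) at_top \<and> ((\<lambda>y. v (x, y)) \<longlongrightarrow> 0) at_bot"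
    and "Linf_norm (dx v) < \<infinity>" and "Linf_norm (dy v) < \<infinity>"
    and "W1inf_norm (\<lambda>p. u p - u0 (snd p)) < ereal \<epsilon>0"
  shows "generalized_inflection_value \<beta> u c"
proof (rule ccontr)
  assume noninfl: "\<not> generalized_inflection_value \<beta> u c"
  note u = \<open>C2_plane u\<close> and v = \<open>C2_plane v\<close>
  have C1u: "C1_plane u" and C1v: "C1_plane v" using u v by (auto simp: C2_plane_def)
  note vort = vorticity_equation[OF u v \<open>traveling_wave_solution L \<beta> c u v\<close>]
  \<comment> \<open>On u = c the vorticity equation reduces to v (\<beta> - laplacian u) = 0, with a
    nonzero second factor.\<close>
  have critical: "v p = 0" if "u p = c" for p
    using vort(2)[of p] noninfl that by (auto simp: generalized_inflection_value_def)

  have Du0: "(u0 has_real_derivative deriv u0 y) (at y)" for y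
    using \<open>C2_line u0\<close> by (simp add: C2_line_def DERIV_deriv_iff_real_differentiable)
  have cont_u0: "continuous_on UNIV u0" "continuous_on UNIV (deriv u0)"
    using \<open>C2_line u0\<close> unfolding C2_line_def
    by (auto intro!: differentiable_imp_continuous_on simp: differentiable_on_def)
  have cont_snd: "continuous_on UNIV (\<lambda>p :: real \<times> real. u0 (snd p))" "continuous_on UNIV (\<lambda>p :: real \<times> real. deriv u0 (snd p))"
    by (rule continuous_on_compose2[OF cont_u0(1)] continuous_on_compose2[OF cont_u0(2)]; auto intro!: continuous_intros)+
  let ?w = "\<lambda>p. u p - u0 (snd p)"
  have dyw: "dy ?w = (\<lambda>p. dy u p - deriv u0 (snd p))"
    by (auto intro!: ext dy_eqI derivative_eq_intros dy_has_derivative[OF C1u] Du0)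
  have "\<bar>?w p\<bar> \<le> \<epsilon>0" for p
    using assms(19) C1_plane_continuous(1)[OF C1u] unfolding W1inf_norm_def
    by (intro continuous_bounded_by_Linf_norm continuous_intros cont_snd) auto
  then have u_close: "\<bar>u (x, y) - u0 y\<bar> \<le> \<epsilon>0" for x y by (metis snd_conv)
  have "\<bar>dy ?w p\<bar> \<le> \<epsilon>0" for p
  proof (rule continuous_bounded_by_Linf_norm)
    show "continuous_on UNIV (dy ?w)"
      unfolding dyw by (intro continuous_intros cont_snd C1_plane_continuous C1u)
    show "Linf_norm (dy ?w) \<le> ereal \<epsilon>0" using assms(19) by (auto simp: W1inf_norm_def)
  qed
  then have dyu_close: "\<bar>dy u (x, y) - deriv u0 y\<bar> \<le> \<epsilon>0" for x y unfolding dyw by (metis snd_conv)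

  have "\<exists>M. \<forall>p. \<bar>f p\<bar> \<le> M" if cf: "continuous_on UNIV f" and fin: "Linf_norm f < \<infinity>" for f
  proof -
    obtain M where "Linf_norm f \<le> ereal M" using fin by (cases "Linf_norm f") auto
    then show ?thesis using continuous_bounded_by_Linf_norm[OF cf] by blast
  qed
  from this[of "dx v"] this[of "dy v"] obtain M1 M2 where M12: "\<And>p. \<bar>dx v p\<bar> \<le> M1" "\<And>p. \<bar>dy v p\<bar> \<le> M2"
    using C1_plane_continuous[OF C1v] assms(17,18) by auto
  define M where "M = max M1 M2"
  have M: "\<bar>dx v p\<bar> \<le> M" "\<bar>dy v p\<bar> \<le> M" for p
    using M12[of p] by (auto simp: M_def)

  obtain R where R: "\<And>y. \<bar>y\<bar> \<ge> R \<Longrightarrow> u0 y \<noteq> 0 \<and> \<bar>deriv u0 y / u0 y\<bar> \<le> C1"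
    using assms(7) by blast
  \<comment> \<open>By the mean value theorem \<open>u0\<close> grows linearly, so that far out it
    dominates \<open>c\<close> and \<open>\<epsilon>0\<close>.\<close>
  have growth: "\<bar>u0 y - u0 0\<bar> \<ge> C0 * \<bar>y\<bar>" for y
  proof -
    have "\<exists>z. u0 y - u0 0 = y * deriv u0 z"
    proof (cases y "0::real" rule: linorder_cases)
      case less
      then obtain z where "u0 0 - u0 y = (0 - y) * deriv u0 z" using MVT2[OF less Du0] by blast
      then show ?thesis by (intro exI[of _ z]) simp
    next
      case greater
      then show ?thesis using MVT2[OF greater Du0] by auto
    qed simp
    then obtain z where "u0 y - u0 0 = y * deriv u0 z" by blast
    then show ?thesis using mult_left_mono[OF assms(6)[rule_format, of z], of "\<bar>y\<bar>"]
      by (simp add: abs_mult mult.commute)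
  qed
  \<comment> \<open>Beyond \<open>Z\<close>, |u0| \<ge> 2 (\<epsilon>0 + |c|) + 1, so |u - c| is at
    least |u0| / 2 and at least 1/2. Hence the bound C1 |u0| on the derivative of \<open>u0\<close>
    contributes \<open>2 * C1\<close>, and the error \<open>\<epsilon>0\<close> in
    \<open>dy u\<close> contributes \<open>2 * \<epsilon>0\<close>.\<close>
  define N where "N = 2 * C1 + 2 * \<epsilon>0"
  define Z where "Z = max R ((\<bar>u0 0\<bar> + 2 * (\<epsilon>0 + \<bar>c\<bar>) + 1) / C0)"
  have N: "\<bar>dy u (x, y)\<bar> \<le> N * \<bar>u (x, y) - c\<bar>" if "\<bar>y\<bar> \<ge> Z" for x y
  proof -
    have y: "\<bar>y\<bar> \<ge> R" "\<bar>y\<bar> \<ge> (\<bar>u0 0\<bar> + 2 * (\<epsilon>0 + \<bar>c\<bar>) + 1) / C0" using that by (auto simp: Z_def)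
    have "\<bar>u0 0\<bar> + 2 * (\<epsilon>0 + \<bar>c\<bar>) + 1 \<le> C0 * \<bar>y\<bar>" using y(2) \<open>C0 > 0\<close> by (simp add: field_simps)
    then have big: "\<bar>u0 y\<bar> \<ge> 2 * (\<epsilon>0 + \<bar>c\<bar>) + 1" using growth[of y] by linarith
    have far: "\<bar>u0 y\<bar> \<le> 2 * \<bar>u (x, y) - c\<bar>" "1 \<le> 2 * \<bar>u (x, y) - c\<bar>"
    proof -
      have *: "U \<le> 2 * W \<and> 1 \<le> 2 * W" if "U \<le> \<epsilon>0 + k + W" "2 * (\<epsilon>0 + k) + 1 \<le> U" "0 \<le> k" for U W k :: real
        using that \<open>0 < \<epsilon>0\<close> by (intro conjI) argo+
      have "\<bar>u0 y\<bar> \<le> \<epsilon>0 + \<bar>c\<bar> + \<bar>u (x, y) - c\<bar>" using u_close[of x y] by linarith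
      from *[OF this big] show "\<bar>u0 y\<bar> \<le> 2 * \<bar>u (x, y) - c\<bar>" "1 \<le> 2 * \<bar>u (x, y) - c\<bar>" by auto
    qed
    have "\<bar>deriv u0 y\<bar> \<le> C1 * \<bar>u0 y\<bar>" using R[OF y(1)] by (auto simp: pos_divide_le_eq)
    also have "\<dots> \<le> C1 * (2 * \<bar>u (x, y) - c\<bar>)" using far \<open>C1 > 0\<close> by (intro mult_left_mono) auto
    finally have "\<bar>dy u (x, y)\<bar> \<le> C1 * (2 * \<bar>u (x, y) - c\<bar>) + \<epsilon>0 * 1" using dyu_close[of x y] by linarith
    also have "\<dots> \<le> C1 * (2 * \<bar>u (x, y) - c\<bar>) + \<epsilon>0 * (2 * \<bar>u (x, y) - c\<bar>)"
      using far \<open>0 < \<epsilon>0\<close> by (intro add_left_mono mult_left_mono) auto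
    finally show ?thesis by (simp add: N_def algebra_simps)
  qed
  have "N \<ge> 0" using \<open>C1 > 0\<close> \<open>0 < \<epsilon>0\<close> by (simp add: N_def)

  consider "\<forall>y. deriv u0 y \<ge> C0" | "\<forall>y. deriv u0 y \<le> - C0"
    using continuous_nonzero_sign[OF cont_u0(2) \<open>C0 > 0\<close>] assms(6) by blast
  then have "\<forall>p. v p = 0"
  proof cases
    case 1
    interpret traveling_profile L \<beta> c "C0 - \<epsilon>0" M N u v
    proof
      show "C0 - \<epsilon>0 \<le> dy u p" for p
        using 1[rule_format, of "snd p"] dyu_close[of "fst p" "snd p"] by simp
      show "\<forall>\<^sub>F y in at_bot. \<forall>x. \<bar>dy u (x, y)\<bar> \<le> N * \<bar>u (x, y) - c\<bar>"
        using eventually_le_at_bot[of "- Z"] by eventually_elim (auto intro!: N)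
    qed (use assms vort M critical \<open>N \<ge> 0\<close> in auto)
    show ?thesis using v_zero by blast
  next
    case 2
    \<comment> \<open>Reflection makes the y-derivative positive and exchanges the two ends, so the
      decay of \<open>v\<close> at the top enters here.\<close>
    interpret traveling_profile L \<beta> c "C0 - \<epsilon>0" M N "reflect 1 u" "reflect (- 1) v"
    proof
      show "dx (reflect 1 u) p + dy (reflect (- 1) v) p = 0" for p
        using vort(1)[of "(fst p, - snd p)"] by (simp add: dx_reflect C1u dy_reflect C1v reflect_def)
      show "(reflect 1 u p - c) * laplacian (reflect (- 1) v) p
          + reflect (- 1) v p * (\<beta> - laplacian (reflect 1 u) p) = 0" for p
        using vort(2)[of "(fst p, - snd p)"] by (simp add: laplacian_reflect u v reflect_def)
      show "C0 - \<epsilon>0 \<le> dy (reflect 1 u) p" for p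
        using 2[rule_format, of "- snd p"] dyu_close[of "fst p" "- snd p"]
        by (simp add: dy_reflect C1u reflect_def)
      show "\<bar>dx (reflect (- 1) v) p\<bar> \<le> M" "\<bar>dy (reflect (- 1) v) p\<bar> \<le> M" for p
        using M[of "(fst p, - snd p)"] by (simp_all add: dx_reflect dy_reflect C1v reflect_def)
      show "((\<lambda>y. reflect (- 1) v (x, y)) \<longlongrightarrow> 0) at_bot" for x
      proof -
        have "((\<lambda>y. v (x, y)) \<longlongrightarrow> 0) at_top" using assms(16) by blast
        then have "((\<lambda>y. v (x, - y)) \<longlongrightarrow> 0) at_bot"
          by (rule filterlim_compose) (rule filterlim_uminus_at_top_at_bot)
        from tendsto_minus[OF this] show ?thesis by (simp add: reflect_def)
      qed
      show "\<forall>\<^sub>F y in at_bot. \<forall>x. \<bar>dy (reflect 1 u) (x, y)\<bar> \<le> N * \<bar>reflect 1 u (x, y) - c\<bar>"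
        using eventually_le_at_bot[of "- Z"]
        by eventually_elim (auto simp: dy_reflect C1u reflect_def intro!: N)
      show "reflect (- 1) v p = 0" if "reflect 1 u p = c" for p
        using that critical by (simp add: reflect_def)
      show "x_periodic L (reflect 1 u)" "x_periodic L (reflect (- 1) v)"
        using assms by (auto simp: x_periodic_def reflect_def)
    qed (use assms \<open>N \<ge> 0\<close> in \<open>auto intro: C2_plane_reflect\<close>)
    have "v (x, y) = 0" for x y using v_zero[of "(x, - y)"] by (simp add: reflect_def)
    then show ?thesis by simp
  qed
  then show False using \<open>\<not> shear_flow u v\<close> by (auto simp: shear_flow_def)
qed

end
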